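(* Let $g$ be a symmetric square integrable function on $[0,T]^2$, and let $$I_t(g):=\int_{[0,t]^2}g(s,\theta)\,dB_\theta dB_s,\quad 0\le t\le T,$$ be the associated double Wiener-Itô integrals. Then, for all $x\ge 0$, $$P\left(\sup_{0\le t\le T}I_t(g)>x\right)\le 2\exp\left(-\frac{x^2}{\left(\|g\|_{L^2([0,T]^2)}+\sqrt{\|g\|_{L^2([0,T]^2)}^2+\sqrt{8}\,\|g\|_{L^2([0,T]^2)}\,x}\right)^2}\right).$$
   Context: $T>0$ is fixed and $B=(B_t)_{t\in[0,T]}$ is a standard Brownian motion on a complete probability space $(\Omega,\mathcal{F},P)$. The function $g$ is deterministic and real-valued. The double Wiener-Itô integral is the usual (off-diagonal) multiple Wiener-Itô integral; for symmetric $g$ it equals the iterated Itô integral $I_t(g)=2\int_0^t\left(\int_0^s g(s,\theta)dB_\theta\right)dB_s$, so that $(I_t(g))_{t\in[0,T]}$ is regarded as a continuous process. *)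

theory Defs
  imports "HOL-Probability.Probability"
begin

text \<open>Paths are only required to be continuous almost surely; since the space is complete,
  this covers the convention of everywhere continuous paths as well.\<close>

locale brownian_motion = prob_space M + complete_measure M
  for M :: "'a measure" +
  fixes T :: real and B :: "real \<Rightarrow> 'a \<Rightarrow> real"
  assumes T_pos: "0 < T"
    and random_variable: "\<And>t. t \<in> {0..T} \<Longrightarrow> B t \<in> borel_measurable M"
    and starts_at_0: "AE \<omega> in M. B 0 \<omega> = 0"
    and indep_increments: "\<And>(n::nat) \<tau> :: nat \<Rightarrow> real.
      0 \<le> \<tau> 0 \<Longrightarrow> \<tau> n \<le> T \<Longrightarrow> (\<And>i. i < n \<Longrightarrow> \<tau> i \<le> \<tau> (Suc i)) \<Longrightarrow>
      indep_vars (\<lambda>_. borel) (\<lambda>i \<omega>. B (\<tau> (Suc i)) \<omega> - B (\<tau> i) \<omega>) {..<n}"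
    and normal_increments: "\<And>s t. 0 \<le> s \<Longrightarrow> s < t \<Longrightarrow> t \<le> T \<Longrightarrow>
      distributed M lborel (\<lambda>\<omega>. B t \<omega> - B s \<omega>) (normal_density 0 (sqrt (t - s)))"
    and continuous_paths: "AE \<omega> in M. continuous_on {0..T} (\<lambda>t. B t \<omega>)"

abbreviation square_measure :: "real \<Rightarrow> (real \<times> real) measure" where
  "square_measure T \<equiv> lebesgue_on ({0..T} \<times> {0..T})"

definition square_integrable_on_square :: "real \<Rightarrow> (real \<times> real \<Rightarrow> real) \<Rightarrow> bool" where
  "square_integrable_on_square T g \<longleftrightarrow>
     g \<in> borel_measurable (square_measure T) \<and> integrable (square_measure T) (\<lambda>p. (g p)\<^sup>2)"

definition L2_norm_square :: "real \<Rightarrow> (real \<times> real \<Rightarrow> real) \<Rightarrow> real" where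
  "L2_norm_square T g = sqrt (\<integral>p. (g p)\<^sup>2 \<partial>square_measure T)"

definition subdivision :: "real \<Rightarrow> nat \<Rightarrow> (nat \<Rightarrow> real) \<Rightarrow> bool" where
  "subdivision T n \<tau> \<longleftrightarrow> \<tau> 0 = 0 \<and> \<tau> n = T \<and> (\<forall>i<n. \<tau> i < \<tau> (Suc i))"

definition step_kernel ::
  "nat \<Rightarrow> (nat \<Rightarrow> real) \<Rightarrow> (nat \<Rightarrow> nat \<Rightarrow> real) \<Rightarrow> real \<times> real \<Rightarrow> real" where
  "step_kernel n \<tau> a p = (\<Sum>i<n. \<Sum>j<n. a i j *
     indicator ({\<tau> i..<\<tau> (Suc i)} \<times> {\<tau> j..<\<tau> (Suc j)}) p)"

definition step_double_integral ::
  "(real \<Rightarrow> 'a \<Rightarrow> real) \<Rightarrow> nat \<Rightarrow> (nat \<Rightarrow> real) \<Rightarrow> (nat \<Rightarrow> nat \<Rightarrow> real) \<Rightarrow> 'a \<Rightarrow> real" where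
  "step_double_integral B n \<tau> a \<omega> = (\<Sum>i<n. \<Sum>j<n. a i j *
     (B (\<tau> (Suc i)) \<omega> - B (\<tau> i) \<omega>) * (B (\<tau> (Suc j)) \<omega> - B (\<tau> j) \<omega>))"

text \<open>The random variable \<open>X\<close> is (a version of) the double Wiener-Ito integral of \<open>f\<close> over the
  square: \<open>X\<close> is the mean-square limit of the double integrals of off-diagonal step functions
  (coefficient 0 on every diagonal cell) that converge to \<open>f\<close> in the \<open>L\<^sup>2\<close> norm.
  The distances are written as nonnegative integrals, so that they are infinite, rather than 0
  by convention, when a difference is not square integrable.\<close>

definition is_double_wiener_ito_integral ::
  "'a measure \<Rightarrow> real \<Rightarrow> (real \<Rightarrow> 'a \<Rightarrow> real) \<Rightarrow> (real \<times> real \<Rightarrow> real) \<Rightarrow> ('a \<Rightarrow> real) \<Rightarrow> bool" where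
  "is_double_wiener_ito_integral M T B f X \<longleftrightarrow>
     X \<in> borel_measurable M \<and>
     (\<exists>(n :: nat \<Rightarrow> nat) \<tau> a.
        (\<forall>k. subdivision T (n k) (\<tau> k) \<and> (\<forall>i < n k. a k i i = 0)) \<and>
        (\<lambda>k. \<integral>\<^sup>+p. ennreal ((f p - step_kernel (n k) (\<tau> k) (a k) p)\<^sup>2) \<partial>square_measure T)
          \<longlonglongrightarrow> 0 \<and>
        (\<lambda>k. \<integral>\<^sup>+\<omega>. ennreal ((X \<omega> - step_double_integral B (n k) (\<tau> k) (a k) \<omega>)\<^sup>2) \<partial>M)
          \<longlonglongrightarrow> 0)"

text \<open>The process of double integrals over \<open>[0,t]\<^sup>2\<close>: each \<open>Y t\<close> is determined only almost
  surely, so the process is pinned down, up to indistinguishability, by requiring continuous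
  paths.\<close>

definition is_double_wiener_ito_process ::
  "'a measure \<Rightarrow> real \<Rightarrow> (real \<Rightarrow> 'a \<Rightarrow> real) \<Rightarrow> (real \<times> real \<Rightarrow> real) \<Rightarrow>
   (real \<Rightarrow> 'a \<Rightarrow> real) \<Rightarrow> bool" where
  "is_double_wiener_ito_process M T B g Y \<longleftrightarrow>
     (\<forall>t\<in>{0..T}. is_double_wiener_ito_integral M T B
        (\<lambda>p. indicator ({0..t} \<times> {0..t}) p * g p) (Y t)) \<and>
     (AE \<omega> in M. continuous_on {0..T} (\<lambda>t. Y t \<omega>))"

end

theory Submission
  imports Defs
begin

text \<open>For an off-diagonal step kernel, the double integrals over \<open>[0,t]\<^sup>2\<close> at the points of the
  subdivision form a discrete martingale \<open>S\<close> driven by independent Gaussian increments. Its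
  predictable bracket \<open>A\<close> is a quadratic form of mean at most \<open>2 \<sigma>\<^sup>2\<close>, where \<open>\<sigma>\<close> is the norm of the
  kernel. For every level \<open>C\<close>, either \<open>A > C\<close> or the exponential martingale
  \<open>exp (l S - l\<^sup>2 A / 2)\<close> with \<open>l = x / C\<close> gets large whenever \<open>S\<close> exceeds \<open>x\<close>. The second event has
  probability at most \<open>exp (- x\<^sup>2 / (2 C))\<close> by Doob's argument; the first one is
  controlled by Jensen's inequality and the exponential moments of squares of Gaussians. With
  \<open>2 C = (\<sigma> + sqrt (\<sigma>\<^sup>2 + sqrt 8 \<sigma> x))\<^sup>2\<close> both bounds coincide, whence the factor 2.

  The general case follows by approximation. The same inequality, applied to differences of step
  kernels on a common refinement, shows that step kernels converging to \<open>g\<close> yield double integrals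
  converging in probability, jointly for finitely many \<open>t\<close>; the supremum over all \<open>t\<close> is then
  reached by continuity of the paths.\<close>

section \<open>Gaussian exponential moments\<close>

lemma nn_integral_normal_density:
  assumes "0 < \<sigma>"
  shows "(\<integral>\<^sup>+y. ennreal (normal_density \<mu> \<sigma> y) \<partial>lborel) = 1"
proof -
  interpret prob_space "density lborel (normal_density \<mu> \<sigma>)"
    using assms by (rule prob_space_normal_density)
  show ?thesis
    using emeasure_space_1 by (simp add: emeasure_density)
qed

text \<open>Completing the square in the exponent. This is the one-dimensional Cameron-Martin shift,
  and it makes the mean-one property of the exponential factor immediate.\<close>

lemma normal_density_exp_tilt:
  assumes "0 < v"
  shows "normal_density 0 (sqrt v) y * exp (\<theta> * y - \<theta>\<^sup>2 * v / 2) = normal_density (\<theta> * v) (sqrt v) y"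
proof -
  have "- (y\<^sup>2) / (2 * v) + (\<theta> * y - \<theta>\<^sup>2 * v / 2) = - ((y - \<theta> * v)\<^sup>2) / (2 * v)"
    using assms by (simp add: field_simps power2_eq_square)
  then show ?thesis
    using assms by (simp add: normal_density_def flip: exp_add)
qed

lemma nn_integral_normal_exp_tilt:
  assumes "0 < v"
  shows "(\<integral>\<^sup>+y. ennreal (exp (\<theta> * y - \<theta>\<^sup>2 * v / 2))
    \<partial>density lborel (normal_density 0 (sqrt v))) = 1"
proof -
  have "(\<integral>\<^sup>+y. ennreal (exp (\<theta> * y - \<theta>\<^sup>2 * v / 2)) \<partial>density lborel (normal_density 0 (sqrt v)))
      = (\<integral>\<^sup>+y. ennreal (normal_density (\<theta> * v) (sqrt v) y) \<partial>lborel)"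
    by (subst nn_integral_density)
      (auto simp: normal_density_exp_tilt[OF assms] simp flip: ennreal_mult)
  then show ?thesis
    using assms by (simp add: nn_integral_normal_density)
qed

text \<open>The exponential of the square only changes the variance from 1 to
  \<open>1 / (1 - q)\<close>; the value is the ratio \<open>s\<close> of the two normalising
  constants.\<close>

lemma nn_integral_normal_exp_square:
  assumes "q < 1"
  shows "(\<integral>\<^sup>+y. ennreal (exp (q * y\<^sup>2 / 2)) \<partial>density lborel std_normal_density)
    = ennreal (1 / sqrt (1 - q))"
proof -
  define s where "s = 1 / sqrt (1 - q)"
  have s: "0 < s" "s\<^sup>2 = 1 / (1 - q)"
    using assms by (auto simp: s_def power_divide)
  have eq: "std_normal_density y * exp (q * y\<^sup>2 / 2) = s * normal_density 0 s y" for y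
  proof -
    have "- (y\<^sup>2) / 2 + q * y\<^sup>2 / 2 = - (y\<^sup>2) / (2 * s\<^sup>2)"
      using assms by (simp add: s field_simps)
    moreover have "sqrt (2 * pi * s\<^sup>2) = sqrt (2 * pi) * s"
      using assms by (simp add: s_def power_divide real_sqrt_mult real_sqrt_divide)
    ultimately show ?thesis
      using s by (simp add: normal_density_def flip: exp_add)
  qed
  have "(\<integral>\<^sup>+y. ennreal (exp (q * y\<^sup>2 / 2)) \<partial>density lborel std_normal_density)
      = (\<integral>\<^sup>+y. ennreal s * ennreal (normal_density 0 s y) \<partial>lborel)"
    using s by (subst nn_integral_density) (auto simp: eq simp flip: ennreal_mult)
  also have "\<dots> = ennreal s"
    using s by (simp add: nn_integral_cmult nn_integral_normal_density)
  finally show ?thesis by (simp add: s_def)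
qed

section \<open>Products of centred Gaussian laws and predictable exponentials\<close>

abbreviation centered_normal :: "real \<Rightarrow> real measure" where
  "centered_normal v \<equiv> density lborel (normal_density 0 (sqrt v))"

abbreviation gauss_product :: "nat \<Rightarrow> (nat \<Rightarrow> real) \<Rightarrow> (nat \<Rightarrow> real) measure" where
  "gauss_product n v \<equiv> PiM {..<n} (\<lambda>i. centered_normal (v i))"

lemma prob_space_gauss_product:
  assumes "\<And>i. 0 < v i"
  shows "prob_space (gauss_product n v)"
  using assms by (intro prob_space_PiM prob_space_normal_density) simp

lemma sets_gauss_product [measurable_cong]:
  "sets (gauss_product n v) = sets (PiM {..<n} (\<lambda>_. borel))"
  by (intro sets_PiM_cong) auto

lemma space_gauss_product:
  "space (gauss_product n v) = space (PiM {..<n} (\<lambda>_. borel))"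
  by (rule sets_eq_imp_space_eq[OF sets_gauss_product])

text \<open>Integrate out the last coordinate first. By \<open>pred\<close>, neither the earlier
  factors nor \<theta> n depend on it, so the inner integral is the tilt identity with a constant
  parameter. Predictability is stated as invariance under updates because points of the product are
  functions on all of nat, and \<open>meas\<close> ranges over every \<open>m\<close> because the
  induction changes the number of coordinates.\<close>

lemma nn_integral_exp_predictable:
  assumes v: "\<And>i. 0 < v i"
    and meas: "\<And>k m. k \<le> m \<Longrightarrow> \<theta> k \<in> borel_measurable (PiM {..<m} (\<lambda>_. borel))"
    and pred: "\<And>k j w y. k \<le> j \<Longrightarrow> \<theta> k (w(j := y)) = \<theta> k w"
  shows "(\<integral>\<^sup>+w. ennreal (exp (\<Sum>k<n. \<theta> k w * w k - (\<theta> k w)\<^sup>2 * v k / 2)) \<partial>gauss_product n v) = 1"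
proof (induction n)
  case 0
  interpret prob_space "gauss_product 0 v" by (rule prob_space_gauss_product[OF v])
  show ?case using emeasure_space_1 by simp
next
  case (Suc n)
  interpret product_sigma_finite "\<lambda>i. centered_normal (v i)"
    by (intro product_sigma_finite.intro prob_space_imp_sigma_finite prob_space_normal_density)
      (simp add: v)
  have [measurable]: "\<theta> k \<in> borel_measurable (gauss_product m v)"
    "(\<lambda>w. w k) \<in> borel_measurable (gauss_product m v)" if "k \<in> {..<m}" for k m
    using meas[of k m] that by (simp_all add: measurable_cong_sets[OF sets_gauss_product refl])
  have [measurable]: "(\<lambda>w. ennreal (exp (\<Sum>k<m. \<theta> k w * w k - (\<theta> k w)\<^sup>2 * v k / 2)))
      \<in> borel_measurable (gauss_product m v)" for m
    by measurable
  have [measurable]: "\<theta> n \<in> borel_measurable (gauss_product n v)"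
    using meas[of n n] by (simp add: measurable_cong_sets[OF sets_gauss_product refl])
  have "(\<integral>\<^sup>+w. ennreal (exp (\<Sum>k<Suc n. \<theta> k w * w k - (\<theta> k w)\<^sup>2 * v k / 2)) \<partial>gauss_product (Suc n) v)
     = (\<integral>\<^sup>+w. (\<integral>\<^sup>+y. ennreal (exp (\<Sum>k<Suc n. \<theta> k (w(n := y)) * (w(n := y)) k
          - (\<theta> k (w(n := y)))\<^sup>2 * v k / 2)) \<partial>centered_normal (v n)) \<partial>gauss_product n v)"
    unfolding lessThan_Suc by (intro product_nn_integral_insert) (simp_all flip: lessThan_Suc)
  also have "\<dots> = (\<integral>\<^sup>+w. (\<integral>\<^sup>+y. ennreal (exp (\<Sum>k<n. \<theta> k w * w k - (\<theta> k w)\<^sup>2 * v k / 2))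
        * ennreal (exp (\<theta> n w * y - (\<theta> n w)\<^sup>2 * v n / 2)) \<partial>centered_normal (v n)) \<partial>gauss_product n v)"
    by (simp add: pred exp_add ennreal_mult)
  also have "\<dots> = (\<integral>\<^sup>+w. ennreal (exp (\<Sum>k<n. \<theta> k w * w k - (\<theta> k w)\<^sup>2 * v k / 2)) \<partial>gauss_product n v)"
    by (simp add: nn_integral_cmult nn_integral_normal_exp_tilt v)
  finally show ?case using Suc by simp
qed

section \<open>Maximal inequality for the exponential martingale\<close>

definition predictable_coeff :: "(nat \<Rightarrow> nat \<Rightarrow> real) \<Rightarrow> nat \<Rightarrow> (nat \<Rightarrow> real) \<Rightarrow> real" where
  "predictable_coeff b k w = (\<Sum>j<k. b k j * w j)"

definition chaos :: "(nat \<Rightarrow> nat \<Rightarrow> real) \<Rightarrow> nat \<Rightarrow> (nat \<Rightarrow> real) \<Rightarrow> real" where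
  "chaos b n w = (\<Sum>k<n. predictable_coeff b k w * w k)"

text \<open>The predictable quadratic variation of \<open>chaos b\<close>, when coordinate k is
  centred with variance \<open>v k\<close>.\<close>

definition bracket :: "(nat \<Rightarrow> nat \<Rightarrow> real) \<Rightarrow> (nat \<Rightarrow> real) \<Rightarrow> nat \<Rightarrow> (nat \<Rightarrow> real) \<Rightarrow> real" where
  "bracket b v n w = (\<Sum>k<n. (predictable_coeff b k w)\<^sup>2 * v k)"

lemma borel_measurable_predictable_coeff:
  "k \<le> m \<Longrightarrow> predictable_coeff b k \<in> borel_measurable (PiM {..<m} (\<lambda>_. borel))"
  unfolding predictable_coeff_def by (intro borel_measurable_sum borel_measurable_times) auto

lemma borel_measurable_chaos:
  "k \<le> m \<Longrightarrow> chaos b k \<in> borel_measurable (PiM {..<m} (\<lambda>_. borel))"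
  unfolding chaos_def
  by (intro borel_measurable_sum borel_measurable_times borel_measurable_predictable_coeff) auto

lemma borel_measurable_bracket:
  "k \<le> m \<Longrightarrow> bracket b v k \<in> borel_measurable (PiM {..<m} (\<lambda>_. borel))"
  unfolding bracket_def
  by (intro borel_measurable_sum borel_measurable_times borel_measurable_power
      borel_measurable_predictable_coeff) auto

lemma predictable_coeff_upd: "k \<le> j \<Longrightarrow> predictable_coeff b k (w(j := y)) = predictable_coeff b k w"
  unfolding predictable_coeff_def by (intro sum.cong) auto

lemma chaos_upd: "k \<le> j \<Longrightarrow> chaos b k (w(j := y)) = chaos b k w"
  unfolding chaos_def by (intro sum.cong) (auto simp: predictable_coeff_upd)

lemma bracket_upd: "k \<le> j \<Longrightarrow> bracket b v k (w(j := y)) = bracket b v k w"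
  unfolding bracket_def by (intro sum.cong) (auto simp: predictable_coeff_upd)

lemma bracket_mono:
  assumes "\<And>i. 0 < v i" "m \<le> n"
  shows "bracket b v m w \<le> bracket b v n w"
  unfolding bracket_def using assms by (intro sum_mono2) (auto simp: less_imp_le)

text \<open>Doob's maximal inequality without a filtration or an optional stopping theorem: the
  stopping is built into the integrand, so that Markov's inequality at the final index and the
  mean-one identity suffice.\<close>

lemma emeasure_gauss_product_maximal:
  assumes v: "\<And>i. 0 < v i"
  shows "emeasure (gauss_product n v) {w \<in> space (gauss_product n v).
      \<exists>m\<le>n. a \<le> l * chaos b m w - l\<^sup>2 / 2 * bracket b v m w} \<le> ennreal (exp (- a))"
    (is "emeasure ?P ?A \<le> _")
proof -
  define L where "L m w = l * chaos b m w - l\<^sup>2 / 2 * bracket b v m w" for m w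
  \<comment> \<open>The integrand is switched off once the level is reached: its exponential martingale is the
    stopped one.\<close>
  define \<theta> where "\<theta> k w = (if \<forall>m\<le>k. L m w < a then l * predictable_coeff b k w else 0)" for k w
  have L_meas: "L k \<in> borel_measurable (PiM {..<m} (\<lambda>_. borel))" if "k \<le> m" for k m
    unfolding L_def by (intro borel_measurable_diff borel_measurable_times borel_measurable_const
        borel_measurable_chaos borel_measurable_bracket that)
  have L_sum: "L m w = (\<Sum>k<m. l * predictable_coeff b k w * w k
      - (l * predictable_coeff b k w)\<^sup>2 * v k / 2)" for m w
    by (simp add: L_def chaos_def bracket_def sum_distrib_left sum_subtractf power_mult_distrib
        mult_ac)
  have \<theta>_meas: "\<theta> k \<in> borel_measurable (PiM {..<m} (\<lambda>_. borel))" if "k \<le> m" for k m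
  proof -
    have "Measurable.pred (PiM {..<m} (\<lambda>_. borel)) (\<lambda>w. L i w < a)" if "i \<in> {..k}" for i
    proof -
      have [measurable]: "L i \<in> borel_measurable (PiM {..<m} (\<lambda>_. borel))"
        using that \<open>k \<le> m\<close> by (intro L_meas) simp
      show ?thesis by measurable
    qed
    then have "Measurable.pred (PiM {..<m} (\<lambda>_. borel)) (\<lambda>w. \<forall>i\<in>{..k}. L i w < a)"
      by (intro pred_intros_finite(3)) auto
    then have "{w \<in> space (PiM {..<m} (\<lambda>_. borel)). \<forall>m\<le>k. L m w < a} \<in> sets (PiM {..<m} (\<lambda>_. borel))"
      by (simp only: pred_def Ball_def atMost_iff)
    moreover have [measurable]: "predictable_coeff b k \<in> borel_measurable (PiM {..<m} (\<lambda>_. borel))"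
      by (rule borel_measurable_predictable_coeff[OF that])
    moreover have "(\<lambda>w. l * predictable_coeff b k w) \<in> borel_measurable (PiM {..<m} (\<lambda>_. borel))"
      by measurable
    ultimately show ?thesis
      unfolding \<theta>_def by (intro measurable_If borel_measurable_const)
  qed
  \<comment> \<open>\<open>L m\<close> reads only the coordinates below \<open>m\<close>. The test
    in \<theta> k may therefore include \<open>m = k\<close> and still leave \<theta> k independent
    of coordinate \<open>k\<close>.\<close>
  have \<theta>_upd: "\<theta> k (w(j := y)) = \<theta> k w" if "k \<le> j" for k j w y
    using that by (auto simp: \<theta>_def L_def predictable_coeff_upd chaos_upd bracket_upd)
  have A: "?A \<in> sets ?P"
  proof -
    have "Measurable.pred (PiM {..<n} (\<lambda>_. borel)) (\<lambda>w. a \<le> L i w)" if "i \<in> {..n}" for i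
    proof -
      have [measurable]: "L i \<in> borel_measurable (PiM {..<n} (\<lambda>_. borel))"
        using that by (intro L_meas) simp
      show ?thesis by measurable
    qed
    then have "Measurable.pred (PiM {..<n} (\<lambda>_. borel)) (\<lambda>w. \<exists>i\<in>{..n}. a \<le> L i w)"
      by (intro pred_intros_finite(4)) auto
    then show ?thesis
      by (simp only: pred_def L_def sets_gauss_product space_gauss_product Bex_def atMost_iff)
  qed
  have stopped: "a \<le> (\<Sum>k<n. \<theta> k w * w k - (\<theta> k w)\<^sup>2 * v k / 2)" if "w \<in> ?A" for w
  proof -
    \<comment> \<open>The first index at which the level is reached. Below it \<theta> carries the
      full integrand, from it on \<theta> vanishes, so the stopped sum up to \<open>n\<close> equals
      \<open>L m w\<close>.\<close>
    define m where "m = (LEAST m. a \<le> L m w)"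
    have "\<exists>m\<le>n. a \<le> L m w" using that by (simp add: L_def)
    then obtain m' where m': "m' \<le> n" "a \<le> L m' w" by blast
    have m: "a \<le> L m w" unfolding m_def using m'(2) by (rule LeastI)
    have "m \<le> n" unfolding m_def using Least_le[of "\<lambda>m. a \<le> L m w", OF m'(2)] m'(1) by simp
    have before: "L k w < a" if "k < m" for k
      using not_less_Least[of k "\<lambda>m. a \<le> L m w"] that by (simp add: m_def)
    have "(\<Sum>k<n. \<theta> k w * w k - (\<theta> k w)\<^sup>2 * v k / 2)
        = (\<Sum>k<m. l * predictable_coeff b k w * w k - (l * predictable_coeff b k w)\<^sup>2 * v k / 2)"
    proof (rule sum.mono_neutral_cong_right)
      show "\<forall>i\<in>{..<n} - {..<m}. \<theta> i w * w i - (\<theta> i w)\<^sup>2 * v i / 2 = 0"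
        using m by (auto simp: \<theta>_def not_less)
      show "\<theta> k w * w k - (\<theta> k w)\<^sup>2 * v k / 2
          = l * predictable_coeff b k w * w k - (l * predictable_coeff b k w)\<^sup>2 * v k / 2"
        if "k \<in> {..<m}" for k
        using before that by (simp add: \<theta>_def)
    qed (use \<open>m \<le> n\<close> in auto)
    then show ?thesis using m by (simp add: L_sum)
  qed
  define K where "K w = (\<Sum>k<n. \<theta> k w * w k - (\<theta> k w)\<^sup>2 * v k / 2)" for w
  have K_meas [measurable]: "K \<in> borel_measurable ?P"
  proof -
    have [measurable]: "\<theta> k \<in> borel_measurable ?P" "(\<lambda>w. w k) \<in> borel_measurable ?P"
      if "k \<in> {..<n}" for k
      using \<theta>_meas[of k n] that by (simp_all add: measurable_cong_sets[OF sets_gauss_product refl])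
    show ?thesis unfolding K_def by measurable
  qed
  have "emeasure ?P ?A = (\<integral>\<^sup>+w. indicator ?A w \<partial>?P)"
    by (rule nn_integral_indicator[OF A, symmetric])
  also have "\<dots> \<le> (\<integral>\<^sup>+w. ennreal (exp (- a)) * ennreal (exp (K w)) \<partial>?P)"
  proof (intro nn_integral_mono)
    fix w
    show "indicator ?A w \<le> ennreal (exp (- a)) * ennreal (exp (K w))"
    proof (cases "w \<in> ?A")
      case True
      have "a \<le> K w" unfolding K_def by (rule stopped[OF True])
      then have "0 \<le> - a + K w" by linarith
      then have "ennreal 1 \<le> ennreal (exp (- a) * exp (K w))"
        by (intro ennreal_leI) (simp flip: exp_add)
      then show ?thesis
        by (simp only: indicator_simps(1)[OF True] ennreal_1 ennreal_mult exp_ge_zero)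
    next
      case False
      show ?thesis by (simp only: indicator_simps(2)[OF False] zero_le)
    qed
  qed
  also have "\<dots> = ennreal (exp (- a)) * (\<integral>\<^sup>+w. ennreal (exp (K w)) \<partial>?P)"
    by (rule nn_integral_cmult) measurable
  also have "(\<integral>\<^sup>+w. ennreal (exp (K w)) \<partial>?P) = 1"
    unfolding K_def by (rule nn_integral_exp_predictable[OF v \<theta>_meas \<theta>_upd])
  finally show ?thesis by (simp only: mult_1_right)
qed

section \<open>Exponential moments of linear Gaussian forms and of their squares\<close>

lemma nn_integral_exp_linear:
  assumes v: "\<And>i. 0 < v i"
  shows "(\<integral>\<^sup>+w. ennreal (exp (\<Sum>j<n. c j * w j)) \<partial>gauss_product n v)
    = ennreal (exp ((\<Sum>j<n. (c j)\<^sup>2 * v j) / 2))"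
proof -
  have meas: "(\<lambda>w. \<Sum>j<n. c j * w j) \<in> borel_measurable (gauss_product n v)"
    by (subst measurable_cong_sets[OF sets_gauss_product refl])
      (intro borel_measurable_sum borel_measurable_times; simp)
  \<comment> \<open>A constant integrand is predictable, and its compensator is deterministic, hence
    comes out of the integral.\<close>
  have "(\<integral>\<^sup>+w. ennreal (exp (\<Sum>j<n. c j * w j)) \<partial>gauss_product n v)
      = (\<integral>\<^sup>+w. ennreal (exp ((\<Sum>j<n. (c j)\<^sup>2 * v j) / 2))
         * ennreal (exp (\<Sum>k<n. c k * w k - (c k)\<^sup>2 * v k / 2)) \<partial>gauss_product n v)"
    by (intro nn_integral_cong)
      (simp add: sum_subtractf sum_divide_distrib flip: ennreal_mult exp_add)
  also have "\<dots> = ennreal (exp ((\<Sum>j<n. (c j)\<^sup>2 * v j) / 2))"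
  proof (subst nn_integral_cmult)
    show "(\<lambda>w. ennreal (exp (\<Sum>k<n. c k * w k - (c k)\<^sup>2 * v k / 2))) \<in> borel_measurable (gauss_product n v)"
      using meas by (simp add: sum_subtractf)
  qed (use nn_integral_exp_predictable[OF v, of "\<lambda>k _. c k"] in simp)
  finally show ?thesis .
qed

text \<open>The square is linearised by \<open>exp (z\<^sup>2 / 2) = E exp (z N)\<close> with an independent standard normal
  \<open>N\<close>.\<close>

lemma nn_integral_exp_square_linear:
  assumes v: "\<And>i. 0 < v i" and q: "0 \<le> q" "q * (\<Sum>j<n. (c j)\<^sup>2 * v j) < 1"
  shows "(\<integral>\<^sup>+w. ennreal (exp (q * (\<Sum>j<n. c j * w j)\<^sup>2 / 2)) \<partial>gauss_product n v)
    = ennreal (1 / sqrt (1 - q * (\<Sum>j<n. (c j)\<^sup>2 * v j)))"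
proof -
  let ?P = "gauss_product n v" and ?N = "density lborel std_normal_density"
  interpret P: prob_space ?P by (rule prob_space_gauss_product[OF v])
  interpret N: prob_space ?N by (rule prob_space_normal_density) simp
  interpret pair_sigma_finite ?P ?N by unfold_locales
  have [measurable]: "(\<lambda>w. \<Sum>j<n. c j * w j) \<in> borel_measurable ?P"
    by (subst measurable_cong_sets[OF sets_gauss_product refl])
      (intro borel_measurable_sum borel_measurable_times; simp)
  have lin: "ennreal (exp (q * z\<^sup>2 / 2)) = (\<integral>\<^sup>+y. ennreal (exp (sqrt q * z * y)) \<partial>?N)" for z
  proof -
    have "(\<integral>\<^sup>+y. ennreal (exp (sqrt q * z * y)) \<partial>?N) = (\<integral>\<^sup>+y. ennreal (exp (q * z\<^sup>2 / 2)) *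
        ennreal (exp (sqrt q * z * y - (sqrt q * z)\<^sup>2 * 1 / 2)) \<partial>?N)"
      using q by (simp add: power_mult_distrib flip: ennreal_mult exp_add)
    also have "\<dots> = ennreal (exp (q * z\<^sup>2 / 2))"
      using nn_integral_normal_exp_tilt[of 1 "sqrt q * z"] by (subst nn_integral_cmult) auto
    finally show ?thesis by simp
  qed
  have "(\<integral>\<^sup>+w. ennreal (exp (q * (\<Sum>j<n. c j * w j)\<^sup>2 / 2)) \<partial>?P)
      = (\<integral>\<^sup>+w. (\<integral>\<^sup>+y. ennreal (exp (sqrt q * (\<Sum>j<n. c j * w j) * y)) \<partial>?N) \<partial>?P)"
    by (simp add: lin)
  \<comment> \<open>After the swap the inner integral is the moment generating function of a linear
    form. This leaves a one-dimensional Gaussian integral of an exponential of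
    \<open>y\<^sup>2\<close>.\<close>
  also have "\<dots> = (\<integral>\<^sup>+y. (\<integral>\<^sup>+w. ennreal (exp (sqrt q * (\<Sum>j<n. c j * w j) * y)) \<partial>?P) \<partial>?N)"
    by (rule Fubini'[symmetric]) measurable
  also have "\<dots> = (\<integral>\<^sup>+y. ennreal (exp (q * (\<Sum>j<n. (c j)\<^sup>2 * v j) * y\<^sup>2 / 2)) \<partial>?N)"
  proof (intro nn_integral_cong)
    fix y
    have "(\<integral>\<^sup>+w. ennreal (exp (sqrt q * (\<Sum>j<n. c j * w j) * y)) \<partial>?P)
        = (\<integral>\<^sup>+w. ennreal (exp (\<Sum>j<n. (sqrt q * y * c j) * w j)) \<partial>?P)"
      by (simp add: sum_distrib_left sum_distrib_right mult_ac)
    also have "\<dots> = ennreal (exp (q * (\<Sum>j<n. (c j)\<^sup>2 * v j) * y\<^sup>2 / 2))"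
      using q by (subst nn_integral_exp_linear[OF v])
        (simp add: sum_distrib_left sum_distrib_right power_mult_distrib mult_ac)
    finally show "(\<integral>\<^sup>+w. ennreal (exp (sqrt q * (\<Sum>j<n. c j * w j) * y)) \<partial>?P)
        = ennreal (exp (q * (\<Sum>j<n. (c j)\<^sup>2 * v j) * y\<^sup>2 / 2))" .
  qed
  also have "\<dots> = ennreal (1 / sqrt (1 - q * (\<Sum>j<n. (c j)\<^sup>2 * v j)))"
    using q by (rule_tac nn_integral_normal_exp_square)
  finally show ?thesis .
qed

section \<open>Tail of the bracket\<close>

text \<open>This is the expectation of \<open>bracket b v n\<close> under
  \<open>gauss_product n v\<close>, the inner sum being the variance of
  \<open>predictable_coeff b k\<close>.\<close>

definition bracket_mean :: "(nat \<Rightarrow> nat \<Rightarrow> real) \<Rightarrow> (nat \<Rightarrow> real) \<Rightarrow> nat \<Rightarrow> real" where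
  "bracket_mean b v n = (\<Sum>k<n. v k * (\<Sum>j<k. (b k j)\<^sup>2 * v j))"

lemma nn_integral_exp_predictable_coeff_square:
  assumes v: "\<And>i. 0 < v i" and "k < n" and q: "0 \<le> q" "q * (\<Sum>j<k. (b k j)\<^sup>2 * v j) < 1"
  shows "(\<integral>\<^sup>+w. ennreal (exp (q * (predictable_coeff b k w)\<^sup>2 / 2)) \<partial>gauss_product n v)
    = ennreal (1 / sqrt (1 - q * (\<Sum>j<k. (b k j)\<^sup>2 * v j)))"
proof -
  \<comment> \<open>Padding with zeros makes the coefficient a linear form in all \<open>n\<close>
    coordinates, so no marginal of the product measure has to be computed.\<close>
  define c where "c j = (if j < k then b k j else 0)" for j
  have "(\<Sum>j<k. b k j * w j) = (\<Sum>j<n. c j * w j)" for w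
    using \<open>k < n\<close> by (intro sum.mono_neutral_cong_left) (auto simp: c_def)
  moreover have "(\<Sum>j<k. (b k j)\<^sup>2 * v j) = (\<Sum>j<n. (c j)\<^sup>2 * v j)"
    using \<open>k < n\<close> by (intro sum.mono_neutral_cong_left) (auto simp: c_def)
  ultimately show ?thesis
    using nn_integral_exp_square_linear[OF v q(1), where c = c and n = n] q(2) by (simp add: predictable_coeff_def)
qed

text \<open>By Jensen's inequality with weights proportional to the variances of the terms of the bracket,
  the worst case is that of a single square.\<close>

lemma nn_integral_exp_bracket_le:
  assumes v: "\<And>i. 0 < v i" and q: "0 \<le> q" "q * bracket_mean b v n < 1"
  shows "(\<integral>\<^sup>+w. ennreal (exp (q * bracket b v n w / 2)) \<partial>gauss_product n v)
    \<le> ennreal (1 / sqrt (1 - q * bracket_mean b v n))"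
proof -
  let ?P = "gauss_product n v" and ?V = "bracket_mean b v n"
  interpret P: prob_space ?P by (rule prob_space_gauss_product[OF v])
  define s where "s k = (\<Sum>j<k. (b k j)\<^sup>2 * v j)" for k
  have s_nonneg: "0 \<le> s k" for k
    unfolding s_def using v by (intro sum_nonneg mult_nonneg_nonneg) (auto simp: less_imp_le)
  have V_eq: "?V = (\<Sum>k<n. v k * s k)" by (simp add: bracket_mean_def s_def)
  \<comment> \<open>A coefficient of variance zero vanishes identically. This settles the terms in
    which the Jensen exponent below divides by \<open>s k = 0\<close>.\<close>
  have coeff_0: "predictable_coeff b k w = 0" if "s k = 0" for k w
  proof -
    have "\<forall>j<k. (b k j)\<^sup>2 * v j = 0"
      using that v unfolding s_def by (subst (asm) sum_nonneg_eq_0_iff) (auto simp: less_imp_le)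
    then have "b k j = 0" if "j < k" for j
      using that v[of j] by auto
    then show ?thesis by (simp add: predictable_coeff_def)
  qed
  have "0 \<le> ?V" unfolding V_eq using v s_nonneg by (intro sum_nonneg) (simp add: less_imp_le)
  show ?thesis
  proof (cases "?V = 0")
    case True
    then have "\<forall>k<n. v k * s k = 0"
      using v s_nonneg unfolding V_eq by (subst (asm) sum_nonneg_eq_0_iff) (auto simp: less_imp_le)
    then have "s k = 0" if "k < n" for k
      using that v[of k] by auto
    then have "bracket b v n w = 0" for w
      by (simp add: bracket_def coeff_0)
    then show ?thesis using True P.emeasure_space_1 by simp
  next
    case False
    with \<open>0 \<le> ?V\<close> have V_pos: "0 < ?V" by simp
    then have "0 < n" by (cases n) (auto simp: bracket_mean_def)
    \<comment> \<open>The factor \<open>?V / s k\<close> rescales each square to the common variance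
      \<open>?V\<close>, so that all terms of positive weight have the same exponential moment
      \<open>1 / sqrt (1 - q * ?V)\<close>. Terms with \<open>s k = 0\<close> have weight
      zero.\<close>
    have Jensen: "exp (q * bracket b v n w / 2)
        \<le> (\<Sum>k<n. v k * s k / ?V * exp (q * ?V / s k * (predictable_coeff b k w)\<^sup>2 / 2))" for w
    proof -
      have eq: "q * bracket b v n w / 2
          = (\<Sum>k<n. (v k * s k / ?V) *\<^sub>R (q * ?V / s k * (predictable_coeff b k w)\<^sup>2 / 2))"
        unfolding bracket_def sum_distrib_left sum_divide_distrib
      proof (intro sum.cong refl)
        fix k
        show "q * ((predictable_coeff b k w)\<^sup>2 * v k) / 2
          = (v k * s k / ?V) *\<^sub>R (q * ?V / s k * (predictable_coeff b k w)\<^sup>2 / 2)"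
          using V_pos coeff_0[of k w] by (cases "s k = 0") auto
      qed
      show ?thesis
        unfolding eq
      proof (rule convex_on_sum[where C = UNIV])
        show "convex_on UNIV (exp :: real \<Rightarrow> real)"
          using convex_on_exp[of 1] by simp
        show "(\<Sum>k<n. v k * s k / ?V) = 1"
          using V_pos V_eq by (simp flip: sum_divide_distrib)
        show "0 \<le> v k * s k / ?V" for k
          using V_pos v[of k] s_nonneg[of k] by simp
      qed (use \<open>0 < n\<close> in auto)
    qed
    have meas: "predictable_coeff b k \<in> borel_measurable ?P" if "k < n" for k
      using borel_measurable_predictable_coeff[of k n b] that
      by (simp add: measurable_cong_sets[OF sets_gauss_product refl])
    have "(\<integral>\<^sup>+w. ennreal (exp (q * bracket b v n w / 2)) \<partial>?P)
        \<le> (\<integral>\<^sup>+w. (\<Sum>k<n. ennreal (v k * s k / ?V)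
          * ennreal (exp (q * ?V / s k * (predictable_coeff b k w)\<^sup>2 / 2))) \<partial>?P)"
    proof (intro nn_integral_mono)
      fix w
      show "ennreal (exp (q * bracket b v n w / 2)) \<le> (\<Sum>k<n. ennreal (v k * s k / ?V)
          * ennreal (exp (q * ?V / s k * (predictable_coeff b k w)\<^sup>2 / 2)))"
        using Jensen[of w] v s_nonneg V_pos
        by (simp add: less_imp_le sum_ennreal ennreal_leI flip: ennreal_mult)
    qed
    also have "\<dots> = (\<Sum>k<n. ennreal (v k * s k / ?V)
        * (\<integral>\<^sup>+w. ennreal (exp (q * ?V / s k * (predictable_coeff b k w)\<^sup>2 / 2)) \<partial>?P))"
      using meas by (subst nn_integral_sum) (auto intro!: sum.cong nn_integral_cmult)
    also have "\<dots> = (\<Sum>k<n. ennreal (v k * s k / ?V) * ennreal (1 / sqrt (1 - q * ?V)))"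
    proof (intro sum.cong refl)
      fix k assume k: "k \<in> {..<n}"
      show "ennreal (v k * s k / ?V)
          * (\<integral>\<^sup>+w. ennreal (exp (q * ?V / s k * (predictable_coeff b k w)\<^sup>2 / 2)) \<partial>?P)
        = ennreal (v k * s k / ?V) * ennreal (1 / sqrt (1 - q * ?V))"
      proof (cases "s k = 0")
        case False
        have "0 \<le> q * ?V / s k" using q V_pos s_nonneg[of k] by simp
        moreover have "q * ?V / s k * (\<Sum>j<k. (b k j)\<^sup>2 * v j) = q * ?V"
          using False by (simp flip: s_def)
        ultimately show ?thesis
          using nn_integral_exp_predictable_coeff_square[OF v, of k n "q * ?V / s k" b] k q by simp
      qed simp
    qed
    also have "\<dots> = ennreal (\<Sum>k<n. v k * s k / ?V) * ennreal (1 / sqrt (1 - q * ?V))"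
      unfolding sum_distrib_right[symmetric]
      using v s_nonneg V_pos by (subst sum_ennreal) (auto simp: less_imp_le)
    also have "(\<Sum>k<n. v k * s k / ?V) = 1"
      using V_pos V_eq by (simp flip: sum_divide_distrib)
    finally show ?thesis by simp
  qed
qed

text \<open>From ln y \<le> y - 1 at y = sqrt t. The prefactor left by the Chernoff bound is
  absorbed and the exponent becomes a perfect square, which can later be matched with
  \<open>x\<^sup>2 / (2 * C)\<close>.\<close>

lemma sqrt_times_exp_le:
  assumes "1 \<le> t"
  shows "sqrt t * exp (- ((t - 1) / 2)) \<le> exp (- ((sqrt t - 1)\<^sup>2 / 2))"
proof -
  have "ln (sqrt t) \<le> sqrt t - 1" using assms by (intro ln_le_minus_one) simp
  moreover have "(sqrt t - 1)\<^sup>2 = t - 2 * sqrt t + 1"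
    using assms by (simp add: power2_diff)
  ultimately have "ln (sqrt t) - (t - 1) / 2 \<le> - ((sqrt t - 1)\<^sup>2 / 2)"
    by (simp add: field_simps)
  then have "exp (ln (sqrt t) - (t - 1) / 2) \<le> exp (- ((sqrt t - 1)\<^sup>2 / 2))" by simp
  moreover have "exp (ln (sqrt t) - (t - 1) / 2) = sqrt t * exp (- ((t - 1) / 2))"
    using assms by (simp only: diff_conv_add_uminus exp_add) simp
  ultimately show ?thesis by simp
qed

lemma emeasure_bracket_tail:
  assumes v: "\<And>i. 0 < v i" and V: "bracket_mean b v n \<le> V" "0 < V" "V \<le> C"
  shows "emeasure (gauss_product n v) {w \<in> space (gauss_product n v). C < bracket b v n w}
    \<le> ennreal (exp (- ((sqrt (C / V) - 1)\<^sup>2 / 2)))" (is "emeasure ?P ?A \<le> _")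
proof -
  \<comment> \<open>The optimal Chernoff parameter:
    \<open>exp (- q * C / 2) / sqrt (1 - q * V)\<close> is stationary in \<open>q\<close> where
    \<open>1 - q * V = V / C\<close>. It is nonnegative because V \<le> C.\<close>
  define q where "q = (1 - V / C) / V"
  have "0 < C" using V by simp
  have q0: "0 \<le> q" and qV: "q * V = 1 - V / C" and qC: "q * C = C / V - 1"
    using V \<open>0 < C\<close> by (auto simp: q_def field_simps)
  have le: "q * bracket_mean b v n \<le> 1 - V / C"
    using mult_left_mono[OF V(1) q0] qV by simp
  then have lt: "q * bracket_mean b v n < 1" using V \<open>0 < C\<close> by (smt (verit) divide_pos_pos)
  have meas: "bracket b v n \<in> borel_measurable ?P"
    using borel_measurable_bracket[of n n b v]
    by (simp add: measurable_cong_sets[OF sets_gauss_product refl])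
  have "emeasure ?P ?A = (\<integral>\<^sup>+w. indicator ?A w \<partial>?P)"
    using meas by simp
  also have "\<dots> \<le> (\<integral>\<^sup>+w. ennreal (exp (- (q * C / 2))) * ennreal (exp (q * bracket b v n w / 2)) \<partial>?P)"
    using q0 by (intro nn_integral_mono)
      (auto simp: indicator_def mult_left_mono less_imp_le simp flip: ennreal_mult exp_add)
  also have "\<dots> = ennreal (exp (- (q * C / 2))) * (\<integral>\<^sup>+w. ennreal (exp (q * bracket b v n w / 2)) \<partial>?P)"
    using meas by (intro nn_integral_cmult) simp
  also have "\<dots> \<le> ennreal (exp (- (q * C / 2))) * ennreal (1 / sqrt (1 - q * bracket_mean b v n))"
    by (intro mult_left_mono nn_integral_exp_bracket_le v q0 lt) simp
  also have "\<dots> \<le> ennreal (exp (- (q * C / 2))) * ennreal (sqrt (C / V))"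
  proof (intro mult_left_mono ennreal_leI)
    have "1 / sqrt (1 - q * bracket_mean b v n) \<le> 1 / sqrt (V / C)"
      using le lt V \<open>0 < C\<close> by (intro divide_left_mono mult_pos_pos) auto
    then show "1 / sqrt (1 - q * bracket_mean b v n) \<le> sqrt (C / V)"
      by (simp add: real_sqrt_divide)
  qed simp
  also have "\<dots> = ennreal (sqrt (C / V) * exp (- ((C / V - 1) / 2)))"
    unfolding qC using V by (simp add: mult.commute flip: ennreal_mult)
  also have "\<dots> \<le> ennreal (exp (- ((sqrt (C / V) - 1)\<^sup>2 / 2)))"
    using V by (intro ennreal_leI sqrt_times_exp_le) simp
  finally show ?thesis .
qed

text \<open>The exponent of the theorem as a function of level and norm, both of which are perturbed
  in the approximation.\<close>

definition tail_exponent :: "real \<Rightarrow> real \<Rightarrow> real" where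
  "tail_exponent x \<sigma> = x\<^sup>2 / (\<sigma> + sqrt (\<sigma>\<^sup>2 + sqrt 8 * \<sigma> * x))\<^sup>2"

lemma emeasure_chaos_maximal:
  assumes v: "\<And>i. 0 < v i" and V: "bracket_mean b v n \<le> 2 * \<sigma>\<^sup>2" and "0 < \<sigma>" "0 < x"
  shows "emeasure (gauss_product n v) {w \<in> space (gauss_product n v). \<exists>m\<le>n. x < chaos b m w}
    \<le> ennreal (2 * exp (- tail_exponent x \<sigma>))" (is "emeasure ?P ?A \<le> _")
proof -
  \<comment> \<open>With \<open>C = u\<^sup>2 / 2\<close>, equality of the two bounds amounts to u *
    (u - 2 * \<sigma>) = sqrt 8 * \<sigma> * x; \<open>u\<close> is the larger root. It is at least
    2 * \<sigma>, which places \<open>C\<close> above the bound \<open>2 * \<sigma>\<^sup>2\<close>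
    on the mean of the bracket.\<close>
  define u where "u = \<sigma> + sqrt (\<sigma>\<^sup>2 + sqrt 8 * \<sigma> * x)"
  define C where "C = u\<^sup>2 / 2"
  have u2: "(u - \<sigma>)\<^sup>2 = \<sigma>\<^sup>2 + sqrt 8 * \<sigma> * x"
    using \<open>0 < \<sigma>\<close> \<open>0 < x\<close> by (simp add: u_def)
  have "2 * \<sigma> \<le> u"
  proof -
    have "sqrt (\<sigma>\<^sup>2) \<le> sqrt (\<sigma>\<^sup>2 + sqrt 8 * \<sigma> * x)"
      using \<open>0 < \<sigma>\<close> \<open>0 < x\<close> by (intro real_sqrt_le_mono) simp
    then show ?thesis using \<open>0 < \<sigma>\<close> by (simp add: u_def)
  qed
  then have "0 < u" using \<open>0 < \<sigma>\<close> by simp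
  then have "0 < C" by (simp add: C_def)
  have ux: "u * (u - 2 * \<sigma>) = sqrt 8 * \<sigma> * x"
    using u2 by (simp add: power2_eq_square algebra_simps)
  have exponent: "tail_exponent x \<sigma> = x\<^sup>2 / (2 * C)"
    by (simp add: tail_exponent_def C_def u_def)
  have "(sqrt (C / (2 * \<sigma>\<^sup>2)) - 1)\<^sup>2 / 2 = x\<^sup>2 / (2 * C)"
  proof -
    have "C / (2 * \<sigma>\<^sup>2) = (u / (2 * \<sigma>))\<^sup>2" by (simp add: C_def power_divide power_mult_distrib)
    then have "sqrt (C / (2 * \<sigma>\<^sup>2)) = u / (2 * \<sigma>)"
      using \<open>0 < u\<close> \<open>0 < \<sigma>\<close> by (simp only: real_sqrt_abs) simp
    then have "sqrt (C / (2 * \<sigma>\<^sup>2)) - 1 = (u - 2 * \<sigma>) / (2 * \<sigma>)"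
      using \<open>0 < \<sigma>\<close> by (simp only: diff_divide_distrib) simp
    also have "\<dots> = sqrt 8 * x / (2 * u)"
      using ux \<open>0 < u\<close> \<open>0 < \<sigma>\<close> by (simp add: field_simps)
    finally have eq: "sqrt (C / (2 * \<sigma>\<^sup>2)) - 1 = sqrt 8 * x / (2 * u)" .
    show ?thesis
      by (simp only: eq) (simp add: C_def power_divide power_mult_distrib)
  qed
  then have eq: "(sqrt (C / (2 * \<sigma>\<^sup>2)) - 1)\<^sup>2 / 2 = tail_exponent x \<sigma>"
    by (simp only: exponent)
  have "(2 * \<sigma>)\<^sup>2 \<le> u\<^sup>2" using \<open>2 * \<sigma> \<le> u\<close> \<open>0 < \<sigma>\<close> by (intro power_mono) simp_all
  then have C_ge: "2 * \<sigma>\<^sup>2 \<le> C" by (simp add: C_def power_mult_distrib)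
  have pos: "0 < 2 * \<sigma>\<^sup>2" using \<open>0 < \<sigma>\<close> by simp
  let ?F = "{w \<in> space ?P. C < bracket b v n w}"
  from emeasure_bracket_tail[OF v V pos C_ge] have tail: "emeasure ?P ?F \<le> ennreal (exp (- tail_exponent x \<sigma>))"
    by (simp only: eq)
  \<comment> \<open>The maximiser of \<open>l * x - l\<^sup>2 / 2 * C\<close>, with maximum
    \<open>x\<^sup>2 / (2 * C)\<close>.\<close>
  define l where "l = x / C"
  have l: "0 \<le> l" "l * x - l\<^sup>2 / 2 * C = tail_exponent x \<sigma>"
    using \<open>0 < C\<close> \<open>0 < x\<close> by (auto simp: l_def exponent power2_eq_square field_simps)
  let ?E = "{w \<in> space ?P. \<exists>m\<le>n. tail_exponent x \<sigma> \<le> l * chaos b m w - l\<^sup>2 / 2 * bracket b v m w}"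
  have sets_P: "sets ?P = sets (PiM {..<n} (\<lambda>_. borel))" by (rule sets_gauss_product)
  have E: "?E \<in> sets ?P"
  proof -
    have "Measurable.pred (PiM {..<n} (\<lambda>_. borel))
        (\<lambda>w. tail_exponent x \<sigma> \<le> l * chaos b i w - l\<^sup>2 / 2 * bracket b v i w)" if "i \<in> {..n}" for i
    proof -
      have [measurable]: "chaos b i \<in> borel_measurable (PiM {..<n} (\<lambda>_. borel))"
        "bracket b v i \<in> borel_measurable (PiM {..<n} (\<lambda>_. borel))"
        using that by (simp_all add: borel_measurable_chaos borel_measurable_bracket)
      show ?thesis by measurable
    qed
    then have "Measurable.pred (PiM {..<n} (\<lambda>_. borel))
        (\<lambda>w. \<exists>m\<in>{..n}. tail_exponent x \<sigma> \<le> l * chaos b m w - l\<^sup>2 / 2 * bracket b v m w)"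
      by (intro pred_intros_finite(4)) auto
    then show ?thesis
      by (simp only: pred_def sets_P space_gauss_product Bex_def atMost_iff)
  qed
  have F: "?F \<in> sets ?P"
  proof -
    have [measurable]: "bracket b v n \<in> borel_measurable ?P"
      using borel_measurable_bracket[of n n b v]
      by (simp add: measurable_cong_sets[OF sets_gauss_product refl])
    show ?thesis by measurable
  qed
  \<comment> \<open>The bracket is nondecreasing in the index, so bounding it at \<open>n\<close>
    bounds it at every \<open>m\<close> where the chaos may exceed \<open>x\<close>.\<close>
  have sub: "?A \<subseteq> ?F \<union> ?E"
  proof
    fix w assume "w \<in> ?A"
    then obtain m where m: "m \<le> n" "x < chaos b m w" and w: "w \<in> space ?P" by auto
    have "tail_exponent x \<sigma> \<le> l * chaos b m w - l\<^sup>2 / 2 * bracket b v m w" if "bracket b v n w \<le> C"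
    proof -
      have "bracket b v m w \<le> C" using bracket_mono[OF v m(1)] that by (rule order_trans)
      then have "l\<^sup>2 / 2 * bracket b v m w \<le> l\<^sup>2 / 2 * C" by (intro mult_left_mono) simp_all
      moreover have "l * x \<le> l * chaos b m w" using l m by (intro mult_left_mono) simp_all
      ultimately show ?thesis using l(2) by linarith
    qed
    then have "C < bracket b v n w \<or> (\<exists>m\<le>n. tail_exponent x \<sigma> \<le> l * chaos b m w - l\<^sup>2 / 2 * bracket b v m w)"
      using m(1) not_less by blast
    then show "w \<in> ?F \<union> ?E"
      using w by (simp only: Un_iff mem_Collect_eq simp_thms)
  qed
  have "emeasure ?P ?A \<le> emeasure ?P (?F \<union> ?E)"
    by (rule emeasure_mono[OF sub sets.Un[OF F E]])
  also have "\<dots> \<le> emeasure ?P ?F + emeasure ?P ?E"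
    by (rule emeasure_subadditive[OF F E])
  also have "\<dots> \<le> ennreal (exp (- tail_exponent x \<sigma>)) + ennreal (exp (- tail_exponent x \<sigma>))"
    by (rule add_mono[OF tail emeasure_gauss_product_maximal[OF v]])
  also have "\<dots> = ennreal (2 * exp (- tail_exponent x \<sigma>))"
    by (simp flip: ennreal_plus)
  finally show ?thesis .
qed

section \<open>Step kernels on refined subdivisions\<close>

text \<open>The terms (i, j) and (j, i) are collected at the larger index, and the zero diagonal
  leaves nothing else. This is the discrete form of writing a double integral as an iterated one;
  adding \<open>a k j\<close> and \<open>a j k\<close> accommodates approximating step kernels that
  are not symmetric.\<close>

lemma quadratic_form_eq_chaos:
  fixes a :: "nat \<Rightarrow> nat \<Rightarrow> real"
  assumes "\<And>i. i < n \<Longrightarrow> a i i = 0"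
  shows "(\<Sum>i<n. \<Sum>j<n. a i j * X i * X j) = chaos (\<lambda>k j. a k j + a j k) n X"
  using assms
proof (induction n)
  case (Suc n)
  have "(\<Sum>i<Suc n. \<Sum>j<Suc n. a i j * X i * X j)
      = (\<Sum>i<n. \<Sum>j<n. a i j * X i * X j) + (\<Sum>j<n. (a n j + a j n) * X j) * X n"
    using Suc.prems[of n]
    by (simp add: sum.distrib sum_distrib_left sum_distrib_right algebra_simps)
  then show ?case using Suc by (simp add: chaos_def predictable_coeff_def)
qed (simp add: chaos_def)

text \<open>By \<open>(x + y)\<^sup>2 \<le> 2 * x\<^sup>2 + 2 * y\<^sup>2\<close> the lower triangle
  of the symmetrised kernel costs at most twice the full energy. This is the source of the bound
  \<open>2 * \<sigma>\<^sup>2\<close>.\<close>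

lemma bracket_mean_symmetrized_le:
  assumes v: "\<And>i. 0 < v i"
  shows "bracket_mean (\<lambda>k j. a k j + a j k) v n \<le> 2 * (\<Sum>i<n. \<Sum>j<n. (a i j)\<^sup>2 * v i * v j)"
proof (induction n)
  case (Suc n)
  have "(a n j + a j n)\<^sup>2 \<le> 2 * (a n j)\<^sup>2 + 2 * (a j n)\<^sup>2" for j
    using zero_le_power2[of "a n j - a j n"] by (simp add: power2_sum power2_diff)
  then have "v n * ((a n j + a j n)\<^sup>2 * v j) \<le> v n * ((2 * (a n j)\<^sup>2 + 2 * (a j n)\<^sup>2) * v j)" for j
    using v by (intro mult_left_mono mult_right_mono) (auto simp: less_imp_le)
  then have "v n * (\<Sum>j<n. (a n j + a j n)\<^sup>2 * v j)
      \<le> (\<Sum>j<n. v n * ((2 * (a n j)\<^sup>2 + 2 * (a j n)\<^sup>2) * v j))"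
    by (simp add: sum_distrib_left sum_mono)
  also have "\<dots> = 2 * (\<Sum>j<n. (a n j)\<^sup>2 * v n * v j) + 2 * (\<Sum>i<n. (a i n)\<^sup>2 * v i * v n)"
    by (simp add: sum.distrib sum_distrib_left algebra_simps)
  also have "\<dots> \<le> 2 * (\<Sum>j<n. (a n j)\<^sup>2 * v n * v j) + 2 * (\<Sum>i<n. (a i n)\<^sup>2 * v i * v n)
      + 2 * ((a n n)\<^sup>2 * v n * v n)"
    using v[of n] by simp
  finally show ?case using Suc by (simp add: bracket_mean_def sum.distrib)
qed (simp add: bracket_mean_def)

section \<open>Order properties of subdivisions\<close>

lemma subdivision_less:
  assumes "subdivision T n \<tau>" "i < j" "j \<le> n"
  shows "\<tau> i < \<tau> j"
  using assms(2,3)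
proof (induction j)
  case (Suc j)
  then have "\<tau> j < \<tau> (Suc j)" using assms(1) by (simp add: subdivision_def)
  then show ?case using Suc by (cases "i = j") auto
qed simp

lemma subdivision_le_iff:
  assumes "subdivision T n \<tau>" "i \<le> n" "j \<le> n"
  shows "\<tau> i \<le> \<tau> j \<longleftrightarrow> i \<le> j"
  using subdivision_less[OF assms(1), of i j] subdivision_less[OF assms(1), of j i] assms(2,3)
  by (cases i j rule: linorder_cases) auto

lemma subdivision_bounds:
  assumes "subdivision T n \<tau>" "i \<le> n"
  shows "0 \<le> \<tau> i" "\<tau> i \<le> T"
  using subdivision_le_iff[OF assms(1), of 0 i] subdivision_le_iff[OF assms(1), of i n] assms
  by (auto simp: subdivision_def)

text \<open>No node lies in the interior of a cell, so comparing a node with a point of a cell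
  reduces to comparing indices. All indicator computations below rest on this.\<close>

lemma subdivision_le_in_cell:
  assumes "subdivision T m \<rho>" "p \<le> m" "i < m" "s \<in> {\<rho> i..<\<rho> (Suc i)}"
  shows "\<rho> p \<le> s \<longleftrightarrow> p \<le> i"
proof
  assume "\<rho> p \<le> s"
  then have "\<not> \<rho> (Suc i) \<le> \<rho> p" using assms(4) by auto
  then show "p \<le> i" using subdivision_le_iff[OF assms(1), of "Suc i" p] assms(2,3) by simp
next
  assume "p \<le> i"
  then show "\<rho> p \<le> s" using subdivision_le_iff[OF assms(1), of p i] assms by auto
qed

text \<open>Sorting the set gives the nodes. It is applied to the union of several node sets to
  produce a common refinement.\<close>

lemma subdivision_of_finite_set:
  assumes "finite F" "F \<subseteq> {0..T}" "0 \<in> F" "T \<in> F"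
  obtains m \<rho> where "subdivision T m \<rho>" "\<rho> ` {..m} = F"
proof -
  define xs where "xs = sorted_list_of_set F"
  have xs: "set xs = F" "sorted_wrt (<) xs"
    using assms(1) by (auto simp: xs_def)
  then have len: "0 < length xs" using assms(3) by auto
  define m where "m = length xs - 1"
  have nth: "xs ! i < xs ! j" if "i < j" "j \<le> m" for i j
    using sorted_wrt_nth_less[OF xs(2)] that len by (simp add: m_def)
  have image: "(!) xs ` {..m} = F"
    using len xs(1) by (force simp: m_def set_conv_nth image_def)
  have nth_le: "xs ! i \<le> xs ! j" if "i \<le> j" "j \<le> m" for i j
    using nth[of i j] that by (cases "i = j") auto
  obtain i where i: "i \<le> m" "xs ! i = 0" using image assms(3) by (metis atMost_iff imageE)
  obtain j where j: "j \<le> m" "xs ! j = T" using image assms(4) by (metis atMost_iff imageE)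
  have range: "xs ! k \<in> {0..T}" if "k \<le> m" for k
    using image assms(2) that by blast
  have "xs ! 0 = 0" using nth_le[of 0 i] i range[of 0] by simp
  moreover have "xs ! m = T" using nth_le[of j m] j range[of m] by simp
  ultimately have "subdivision T m ((!) xs)" using nth by (simp add: subdivision_def)
  then show thesis using image that by blast
qed

text \<open>Kernels are handled as functions instead of coefficient arrays, so that differences and
  restrictions on a common refinement need no new coefficients. The cells are half-open; points with
  a coordinate T are left unconstrained.\<close>

definition cell_constant :: "nat \<Rightarrow> (nat \<Rightarrow> real) \<Rightarrow> (real \<times> real \<Rightarrow> real) \<Rightarrow> bool" where
  "cell_constant m \<rho> f \<longleftrightarrow> (\<forall>i<m. \<forall>j<m. \<forall>s\<in>{\<rho> i..<\<rho> (Suc i)}. \<forall>\<theta>\<in>{\<rho> j..<\<rho> (Suc j)}.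
     f (s, \<theta>) = f (\<rho> i, \<rho> j))"

lemma cell_constantD:
  assumes "cell_constant m \<rho> f" "i < m" "j < m" "s \<in> {\<rho> i..<\<rho> (Suc i)}" "\<theta> \<in> {\<rho> j..<\<rho> (Suc j)}"
  shows "f (s, \<theta>) = f (\<rho> i, \<rho> j)"
  using assms unfolding cell_constant_def by blast

text \<open>For a kernel constant on the cells this is the double integral over the square up to
  time \<rho> r; varying \<open>r\<close> gives the process at the nodes.\<close>

definition quad_sum ::
  "(real \<Rightarrow> 'a \<Rightarrow> real) \<Rightarrow> (nat \<Rightarrow> real) \<Rightarrow> (real \<times> real \<Rightarrow> real) \<Rightarrow> nat \<Rightarrow> 'a \<Rightarrow> real" where
  "quad_sum B \<rho> f r \<omega> = (\<Sum>i<r. \<Sum>j<r. f (\<rho> i, \<rho> j) *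
     (B (\<rho> (Suc i)) \<omega> - B (\<rho> i) \<omega>) * (B (\<rho> (Suc j)) \<omega> - B (\<rho> j) \<omega>))"

lemma indicator_cell_eq:
  assumes "subdivision T m \<rho>" "i < m" "s \<in> {\<rho> i..<\<rho> (Suc i)}" "k < m"
  shows "indicator {\<rho> k..<\<rho> (Suc k)} s = (if k = i then 1 else (0::'b::zero_neq_one))"
  using subdivision_le_in_cell[OF assms(1) _ assms(2,3), of k]
    subdivision_le_in_cell[OF assms(1) _ assms(2,3), of "Suc k"] assms
  by (auto simp: indicator_def)

lemma indicator_refined_cell:
  assumes \<rho>: "subdivision T m \<rho>" and "p \<le> m" "q \<le> m" and i: "i < m" "s \<in> {\<rho> i..<\<rho> (Suc i)}"
  shows "indicator {\<rho> p..<\<rho> q} s = (if i \<in> {p..<q} then 1 else (0::'b::zero_neq_one))"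
  using subdivision_le_in_cell[OF \<rho> \<open>p \<le> m\<close> i] subdivision_le_in_cell[OF \<rho> \<open>q \<le> m\<close> i]
  by (auto simp: indicator_def)

lemma cell_left_end:
  assumes "subdivision T m \<rho>" "i < m"
  shows "\<rho> i \<in> {\<rho> i..<\<rho> (Suc i)}"
  using assms by (simp add: subdivision_def)

lemma step_kernel_alt:
  "step_kernel n \<tau> a (s, \<theta>) = (\<Sum>i<n. \<Sum>j<n. a i j *
     indicator {\<tau> i..<\<tau> (Suc i)} s * indicator {\<tau> j..<\<tau> (Suc j)} \<theta>)"
  by (simp add: step_kernel_def indicator_times mult.assoc)

text \<open>The cells of a subdivision are disjoint, so a diagonal point can only meet a diagonal
  cell. Stated for points, the vanishing passes to every refinement.\<close>

lemma step_kernel_diagonal: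
  assumes "subdivision T n \<tau>" "\<And>i. i < n \<Longrightarrow> a i i = 0"
  shows "step_kernel n \<tau> a (s, s) = 0"
  unfolding step_kernel_alt
proof (intro sum.neutral ballI)
  fix i j assume ij: "i \<in> {..<n}" "j \<in> {..<n}"
  show "a i j * indicator {\<tau> i..<\<tau> (Suc i)} s * indicator {\<tau> j..<\<tau> (Suc j)} s = 0"
  proof (cases "s \<in> {\<tau> i..<\<tau> (Suc i)}")
    case True
    then show ?thesis
      using indicator_cell_eq[OF assms(1) _ True, of j, where 'b = real] ij assms(2) by auto
  qed simp
qed

lemma refinement_cells:
  assumes "\<tau> ` {..n} \<subseteq> \<rho> ` {..m}" "i < n"
  obtains p q where "p \<le> m" "q \<le> m" "\<tau> i = \<rho> p" "\<tau> (Suc i) = \<rho> q"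
proof -
  have "\<tau> i \<in> \<rho> ` {..m}" "\<tau> (Suc i) \<in> \<rho> ` {..m}" using assms by auto
  then show thesis using that by auto
qed

text \<open>The coarse nodes are among the fine ones, hence each coarse indicator is constant on
  every fine cell.\<close>

lemma cell_constant_step_kernel:
  assumes \<rho>: "subdivision T m \<rho>" and sub: "\<tau> ` {..n} \<subseteq> \<rho> ` {..m}"
  shows "cell_constant m \<rho> (step_kernel n \<tau> a)"
proof -
  have ind: "indicator {\<tau> k..<\<tau> (Suc k)} s = (indicator {\<tau> k..<\<tau> (Suc k)} (\<rho> i) :: real)"
    if "k < n" "i < m" "s \<in> {\<rho> i..<\<rho> (Suc i)}" for k i s
  proof -
    obtain p q where pq: "p \<le> m" "q \<le> m" "\<tau> k = \<rho> p" "\<tau> (Suc k) = \<rho> q"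
      using refinement_cells[OF sub \<open>k < n\<close>] .
    show ?thesis
      unfolding pq(3,4)
      using indicator_refined_cell[OF \<rho> pq(1,2) that(2,3), where 'b = real]
        indicator_refined_cell[where 'b = real, OF \<rho> pq(1,2) that(2) cell_left_end[OF \<rho> that(2)]]
      by simp
  qed
  show ?thesis
    unfolding cell_constant_def step_kernel_alt
  proof (intro allI impI ballI sum.cong refl)
    fix i j s \<theta> k l
    assume "i < m" "j < m" "s \<in> {\<rho> i..<\<rho> (Suc i)}" "\<theta> \<in> {\<rho> j..<\<rho> (Suc j)}"
      "k \<in> {..<n}" "l \<in> {..<n}"
    then show "a k l * indicator {\<tau> k..<\<tau> (Suc k)} s * indicator {\<tau> l..<\<tau> (Suc l)} \<theta>
        = a k l * indicator {\<tau> k..<\<tau> (Suc k)} (\<rho> i) * indicator {\<tau> l..<\<tau> (Suc l)} (\<rho> j)"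
      using ind[of k i s] ind[of l j \<theta>] by (simp only: lessThan_iff)
  qed
qed

lemma sum_indicator_increment:
  assumes \<rho>: "subdivision T m \<rho>" and pq: "p \<le> q" "q \<le> m"
  shows "(\<Sum>j<m. indicator {\<rho> p..<\<rho> q} (\<rho> j) * (h (\<rho> (Suc j)) - h (\<rho> j))) = h (\<rho> q) - (h (\<rho> p) :: real)"
proof -
  have "(\<Sum>j<m. indicator {\<rho> p..<\<rho> q} (\<rho> j) * (h (\<rho> (Suc j)) - h (\<rho> j)))
      = (\<Sum>j\<in>{p..<q}. h (\<rho> (Suc j)) - h (\<rho> j))"
    using pq
    by (intro sum.mono_neutral_cong_right)
      (auto simp: indicator_refined_cell[OF \<rho> _ _ _ cell_left_end[OF \<rho>]])
  also have "\<dots> = h (\<rho> q) - h (\<rho> p)"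
    using sum_Suc_diff'[OF pq(1), of "\<lambda>j. h (\<rho> j)"] .
  finally show ?thesis .
qed

text \<open>The double integral of a step kernel does not change under refinement, because the fine
  increments inside a coarse cell telescope. Integrals over different subdivisions thus become
  comparable.\<close>

lemma quad_sum_step_kernel:
  assumes \<tau>: "subdivision T n \<tau>" and \<rho>: "subdivision T m \<rho>" and sub: "\<tau> ` {..n} \<subseteq> \<rho> ` {..m}"
  shows "quad_sum B \<rho> (step_kernel n \<tau> a) m \<omega> = step_double_integral B n \<tau> a \<omega>"
proof -
  define D where "D j = B (\<rho> (Suc j)) \<omega> - B (\<rho> j) \<omega>" for j
  define I where "I i j = (indicator {\<tau> i..<\<tau> (Suc i)} (\<rho> j) :: real)" for i j
  have incr: "(\<Sum>j<m. I i j * D j) = B (\<tau> (Suc i)) \<omega> - B (\<tau> i) \<omega>" if "i < n" for i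
  proof -
    obtain p q where pq: "p \<le> m" "q \<le> m" "\<tau> i = \<rho> p" "\<tau> (Suc i) = \<rho> q"
      using refinement_cells[OF sub \<open>i < n\<close>] .
    have "\<rho> p \<le> \<rho> q" using \<tau> \<open>i < n\<close> by (simp add: subdivision_def less_imp_le flip: pq(3,4))
    then have "p \<le> q" using subdivision_le_iff[OF \<rho> pq(1,2)] by simp
    then show ?thesis
      using sum_indicator_increment[OF \<rho> _ pq(2), of p "\<lambda>t. B t \<omega>"] by (simp add: I_def D_def pq)
  qed
  have "quad_sum B \<rho> (step_kernel n \<tau> a) m \<omega>
      = (\<Sum>j<m. \<Sum>l<m. \<Sum>i<n. \<Sum>k<n. a i k * (I i j * D j) * (I k l * D l))"
    by (simp add: quad_sum_def step_kernel_alt D_def I_def sum_distrib_left sum_distrib_right mult_ac)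
  \<comment> \<open>The interchanges bring the coarse indices \<open>i\<close>, \<open>k\<close>
    outside. The sums over \<open>j\<close> and \<open>l\<close> then factor, and each telescopes to
    a coarse increment.\<close>
  also have "\<dots> = (\<Sum>j<m. \<Sum>i<n. \<Sum>l<m. \<Sum>k<n. a i k * (I i j * D j) * (I k l * D l))"
    by (intro sum.cong refl sum.swap)
  also have "\<dots> = (\<Sum>i<n. \<Sum>j<m. \<Sum>l<m. \<Sum>k<n. a i k * (I i j * D j) * (I k l * D l))"
    by (rule sum.swap)
  also have "\<dots> = (\<Sum>i<n. \<Sum>j<m. \<Sum>k<n. \<Sum>l<m. a i k * (I i j * D j) * (I k l * D l))"
    by (intro sum.cong refl sum.swap)
  also have "\<dots> = (\<Sum>i<n. \<Sum>k<n. \<Sum>j<m. \<Sum>l<m. a i k * (I i j * D j) * (I k l * D l))"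
    by (intro sum.cong refl sum.swap)
  also have "\<dots> = (\<Sum>i<n. \<Sum>k<n. a i k * (\<Sum>j<m. I i j * D j) * (\<Sum>l<m. I k l * D l))"
    by (simp only: sum_distrib_left[symmetric] sum_distrib_right[symmetric])
  also have "\<dots> = step_double_integral B n \<tau> a \<omega>"
    by (simp add: step_double_integral_def incr)
  finally show ?thesis .
qed

lemma cell_constant_diff:
  assumes f: "cell_constant m \<rho> f" and h: "cell_constant m \<rho> h"
  shows "cell_constant m \<rho> (\<lambda>p. f p - h p)"
  unfolding cell_constant_def
proof (intro allI impI ballI)
  fix i j s \<theta>
  assume ij: "i < m" "j < m" "s \<in> {\<rho> i..<\<rho> (Suc i)}" "\<theta> \<in> {\<rho> j..<\<rho> (Suc j)}"
  show "f (s, \<theta>) - h (s, \<theta>) = f (\<rho> i, \<rho> j) - h (\<rho> i, \<rho> j)"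
    by (simp only: cell_constantD[OF f ij] cell_constantD[OF h ij])
qed

lemma cell_constant_uminus:
  assumes f: "cell_constant m \<rho> f"
  shows "cell_constant m \<rho> (\<lambda>p. - f p)"
  unfolding cell_constant_def
proof (intro allI impI ballI)
  fix i j s \<theta>
  assume ij: "i < m" "j < m" "s \<in> {\<rho> i..<\<rho> (Suc i)}" "\<theta> \<in> {\<rho> j..<\<rho> (Suc j)}"
  show "- f (s, \<theta>) = - f (\<rho> i, \<rho> j)"
    by (simp only: cell_constantD[OF f ij])
qed

lemma quad_sum_diff:
  "quad_sum B \<rho> (\<lambda>p. f p - h p) r \<omega> = quad_sum B \<rho> f r \<omega> - quad_sum B \<rho> h r \<omega>"
  by (simp add: quad_sum_def sum_subtractf left_diff_distrib)

lemma quad_sum_uminus: "quad_sum B \<rho> (\<lambda>p. - f p) r \<omega> = - quad_sum B \<rho> f r \<omega>"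
  by (simp add: quad_sum_def sum_negf)

text \<open>The half-open square keeps kernels constant on the half-open cells; it differs from the closed
  square of the definition of the process by a null set.\<close>

definition restrict_kernel :: "real \<Rightarrow> (real \<times> real \<Rightarrow> real) \<Rightarrow> real \<times> real \<Rightarrow> real" where
  "restrict_kernel t f p = indicator ({0..<t} \<times> {0..<t}) p * f p"

lemma indicator_initial_segment:
  assumes \<rho>: "subdivision T m \<rho>" and "r \<le> m" "i < m" "s \<in> {\<rho> i..<\<rho> (Suc i)}"
  shows "indicator {0..<\<rho> r} s = (if i < r then 1 else (0::real))"
proof -
  have "\<rho> 0 = 0" using \<rho> by (simp add: subdivision_def)
  then show ?thesis using indicator_refined_cell[OF \<rho> _ assms(2-4), of 0] by simp
qed

lemma cell_constant_restrict_kernel: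
  assumes \<rho>: "subdivision T m \<rho>" and "r \<le> m" and f: "cell_constant m \<rho> f"
  shows "cell_constant m \<rho> (restrict_kernel (\<rho> r) f)"
  unfolding cell_constant_def restrict_kernel_def indicator_times fst_conv snd_conv
proof (intro allI impI ballI)
  fix i j s \<theta>
  assume ij: "i < m" "j < m" "s \<in> {\<rho> i..<\<rho> (Suc i)}" "\<theta> \<in> {\<rho> j..<\<rho> (Suc j)}"
  have "f (s, \<theta>) = f (\<rho> i, \<rho> j)" by (rule cell_constantD[OF f ij])
  then show "indicator {0..<\<rho> r} s * indicator {0..<\<rho> r} \<theta> * f (s, \<theta>)
      = indicator {0..<\<rho> r} (\<rho> i) * indicator {0..<\<rho> r} (\<rho> j) * f (\<rho> i, \<rho> j)"
    using indicator_initial_segment[OF \<rho> \<open>r \<le> m\<close> ij(1,3)]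
      indicator_initial_segment[OF \<rho> \<open>r \<le> m\<close> ij(2,4)]
      indicator_initial_segment[OF \<rho> \<open>r \<le> m\<close> ij(1) cell_left_end[OF \<rho> ij(1)]]
      indicator_initial_segment[OF \<rho> \<open>r \<le> m\<close> ij(2) cell_left_end[OF \<rho> ij(2)]]
    by simp
qed

text \<open>Stopping at a node is a change of kernel. The value at that time can then be compared,
  by linearity, with another integral over the whole square.\<close>

lemma quad_sum_restrict_kernel:
  assumes \<rho>: "subdivision T m \<rho>" and "r \<le> m"
  shows "quad_sum B \<rho> (restrict_kernel (\<rho> r) f) m \<omega> = quad_sum B \<rho> f r \<omega>"
proof -
  have ind: "indicator {0..<\<rho> r} (\<rho> i) = (if i < r then 1 else (0::real))" if "i < m" for i
    using indicator_initial_segment[OF \<rho> \<open>r \<le> m\<close> that cell_left_end[OF \<rho> that]] .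
  show ?thesis
    unfolding quad_sum_def restrict_kernel_def indicator_times fst_conv snd_conv using \<open>r \<le> m\<close>
    by (intro sum.mono_neutral_cong_right) (auto simp: ind intro!: sum.mono_neutral_cong_right)
qed

section \<open>Energy of cell-constant kernels\<close>

lemma emeasure_square_measure_cell:
  assumes \<rho>: "subdivision T m \<rho>" and "i < m" "j < m"
  shows "emeasure (square_measure T) ({\<rho> i..<\<rho> (Suc i)} \<times> {\<rho> j..<\<rho> (Suc j)})
    = ennreal ((\<rho> (Suc i) - \<rho> i) * (\<rho> (Suc j) - \<rho> j))"
    "{\<rho> i..<\<rho> (Suc i)} \<times> {\<rho> j..<\<rho> (Suc j)} \<in> sets (square_measure T)"
proof -
  let ?C = "{\<rho> i..<\<rho> (Suc i)} \<times> {\<rho> j..<\<rho> (Suc j)}"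
  have le: "\<rho> i \<le> \<rho> (Suc i)" "\<rho> j \<le> \<rho> (Suc j)"
    using assms by (auto simp: subdivision_def less_imp_le)
  have C: "?C \<in> sets borel" by (simp add: borel_Times)
  have sub: "?C \<subseteq> {0..T} \<times> {0..T}"
    using subdivision_bounds[OF \<rho>, of i] subdivision_bounds[OF \<rho>, of "Suc i"]
      subdivision_bounds[OF \<rho>, of j] subdivision_bounds[OF \<rho>, of "Suc j"] assms(2,3) by auto
  have Q: "{0..T} \<times> {0..T} \<in> sets borel" by (simp add: borel_Times)
  show "?C \<in> sets (square_measure T)"
    using C sub by (simp add: sets_restrict_space_iff sets_completionI_sets Q)
  have "emeasure (square_measure T) ?C = emeasure lborel ?C"
    using C sub Q by (subst emeasure_restrict_space) auto
  also have "\<dots> = emeasure lborel {\<rho> i..<\<rho> (Suc i)} * emeasure lborel {\<rho> j..<\<rho> (Suc j)}"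
    by (simp add: lborel_prod[symmetric] lborel.emeasure_pair_measure_Times)
  also have "\<dots> = ennreal ((\<rho> (Suc i) - \<rho> i) * (\<rho> (Suc j) - \<rho> j))"
    using le by (simp add: ennreal_mult)
  finally show "emeasure (square_measure T) ?C
    = ennreal ((\<rho> (Suc i) - \<rho> i) * (\<rho> (Suc j) - \<rho> j))" .
qed

text \<open>The cells are disjoint, so the step function built from the squared node values is
  dominated pointwise by \<open>(f p)\<^sup>2\<close>, with equality on the cells. Points with a
  coordinate T lie in no cell; the inequality passes over them.\<close>

lemma cell_constant_energy_le:
  assumes \<rho>: "subdivision T m \<rho>" and f: "cell_constant m \<rho> f"
  shows "ennreal (\<Sum>i<m. \<Sum>j<m. (f (\<rho> i, \<rho> j))\<^sup>2 * (\<rho> (Suc i) - \<rho> i) * (\<rho> (Suc j) - \<rho> j))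
    \<le> (\<integral>\<^sup>+p. ennreal ((f p)\<^sup>2) \<partial>square_measure T)"
proof -
  define C where "C i j = {\<rho> i..<\<rho> (Suc i)} \<times> {\<rho> j..<\<rho> (Suc j)}" for i j
  have le: "0 \<le> \<rho> (Suc i) - \<rho> i" if "i < m" for i
    using \<rho> that by (simp add: subdivision_def less_imp_le)
  have "ennreal (\<Sum>i<m. \<Sum>j<m. (f (\<rho> i, \<rho> j))\<^sup>2 * (\<rho> (Suc i) - \<rho> i) * (\<rho> (Suc j) - \<rho> j))
      = (\<Sum>i<m. \<Sum>j<m. ennreal ((f (\<rho> i, \<rho> j))\<^sup>2) * emeasure (square_measure T) (C i j))"
  proof -
    have "ennreal ((f (\<rho> i, \<rho> j))\<^sup>2) * emeasure (square_measure T) (C i j)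
        = ennreal ((f (\<rho> i, \<rho> j))\<^sup>2 * (\<rho> (Suc i) - \<rho> i) * (\<rho> (Suc j) - \<rho> j))"
      if "i < m" "j < m" for i j
      unfolding C_def emeasure_square_measure_cell(1)[OF \<rho> that]
      using le that by (simp add: mult.assoc flip: ennreal_mult)
    then have "(\<Sum>i<m. \<Sum>j<m. ennreal ((f (\<rho> i, \<rho> j))\<^sup>2) * emeasure (square_measure T) (C i j))
      = (\<Sum>i<m. \<Sum>j<m. ennreal ((f (\<rho> i, \<rho> j))\<^sup>2 * (\<rho> (Suc i) - \<rho> i) * (\<rho> (Suc j) - \<rho> j)))"
      by simp
    also have "\<dots> = ennreal (\<Sum>i<m. \<Sum>j<m. (f (\<rho> i, \<rho> j))\<^sup>2 * (\<rho> (Suc i) - \<rho> i) * (\<rho> (Suc j) - \<rho> j))"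
    proof -
      have nonneg: "0 \<le> (f (\<rho> i, \<rho> j))\<^sup>2 * (\<rho> (Suc i) - \<rho> i) * (\<rho> (Suc j) - \<rho> j)"
        if "i < m" "j < m" for i j
        using le[OF that(1)] le[OF that(2)] by (intro mult_nonneg_nonneg) simp_all
      have "(\<Sum>j<m. ennreal ((f (\<rho> i, \<rho> j))\<^sup>2 * (\<rho> (Suc i) - \<rho> i) * (\<rho> (Suc j) - \<rho> j)))
          = ennreal (\<Sum>j<m. (f (\<rho> i, \<rho> j))\<^sup>2 * (\<rho> (Suc i) - \<rho> i) * (\<rho> (Suc j) - \<rho> j))"
        if "i < m" for i
        using nonneg[OF that] by (intro sum_ennreal) simp
      then show ?thesis
        using nonneg by (subst sum_ennreal[symmetric]) (auto intro!: sum_nonneg)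
    qed
    finally show ?thesis by simp
  qed
  also have "\<dots> = (\<integral>\<^sup>+p. (\<Sum>i<m. \<Sum>j<m. ennreal ((f (\<rho> i, \<rho> j))\<^sup>2) * indicator (C i j) p) \<partial>square_measure T)"
  proof -
    have C [measurable]: "C i j \<in> sets (square_measure T)" if "i < m" "j < m" for i j
      unfolding C_def by (rule emeasure_square_measure_cell(2)[OF \<rho> that])
    have ind: "(\<lambda>p. ennreal ((f (\<rho> i, \<rho> j))\<^sup>2) * indicator (C i j) p) \<in> borel_measurable (square_measure T)"
      if "i < m" "j < m" for i j
      using C[OF that] by measurable
    have "(\<integral>\<^sup>+p. (\<Sum>i<m. \<Sum>j<m. ennreal ((f (\<rho> i, \<rho> j))\<^sup>2) * indicator (C i j) p) \<partial>square_measure T)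
        = (\<Sum>i<m. \<integral>\<^sup>+p. (\<Sum>j<m. ennreal ((f (\<rho> i, \<rho> j))\<^sup>2) * indicator (C i j) p) \<partial>square_measure T)"
      using ind by (intro nn_integral_sum borel_measurable_sum) simp
    also have "\<dots> = (\<Sum>i<m. \<Sum>j<m. \<integral>\<^sup>+p. ennreal ((f (\<rho> i, \<rho> j))\<^sup>2) * indicator (C i j) p \<partial>square_measure T)"
      using ind by (intro sum.cong refl nn_integral_sum) simp
    also have "\<dots> = (\<Sum>i<m. \<Sum>j<m. ennreal ((f (\<rho> i, \<rho> j))\<^sup>2) * emeasure (square_measure T) (C i j))"
      using C by (intro sum.cong refl nn_integral_cmult_indicator) simp
    finally show ?thesis by (rule sym)
  qed
  also have "\<dots> \<le> (\<integral>\<^sup>+p. ennreal ((f p)\<^sup>2) \<partial>square_measure T)"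
  proof (intro nn_integral_mono)
    fix p :: "real \<times> real"
    define s \<theta> where "s = fst p" and "\<theta> = snd p"
    then have p: "p = (s, \<theta>)" by simp
    show "(\<Sum>i<m. \<Sum>j<m. ennreal ((f (\<rho> i, \<rho> j))\<^sup>2) * indicator (C i j) p) \<le> ennreal ((f p)\<^sup>2)"
    proof (cases "\<exists>k l. k < m \<and> l < m \<and> p \<in> C k l")
      case True
      then obtain k l where kl: "k < m" "l < m" "s \<in> {\<rho> k..<\<rho> (Suc k)}" "\<theta> \<in> {\<rho> l..<\<rho> (Suc l)}"
        by (auto simp: C_def p)
      have fp: "f p = f (\<rho> k, \<rho> l)" unfolding p by (rule cell_constantD[OF f kl])
      have "(\<Sum>j<m. ennreal ((f (\<rho> i, \<rho> j))\<^sup>2) * indicator (C i j) p)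
          = (if i = k then ennreal ((f p)\<^sup>2) else 0)" if "i < m" for i
      proof -
        have "(\<Sum>j<m. ennreal ((f (\<rho> i, \<rho> j))\<^sup>2) * indicator (C i j) p)
            = (\<Sum>j<m. if j = l then (if i = k then ennreal ((f (\<rho> i, \<rho> j))\<^sup>2) else 0) else 0)"
          using indicator_cell_eq[OF \<rho> kl(1,3) that, where 'b = ennreal]
            indicator_cell_eq[OF \<rho> kl(2,4), where 'b = ennreal]
          by (intro sum.cong refl) (simp add: C_def p indicator_times)
        then show ?thesis using kl(2) fp by (simp add: sum.delta)
      qed
      then have "(\<Sum>i<m. \<Sum>j<m. ennreal ((f (\<rho> i, \<rho> j))\<^sup>2) * indicator (C i j) p)
          = (\<Sum>i<m. if i = k then ennreal ((f p)\<^sup>2) else 0)"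
        by (intro sum.cong refl) simp
      then show ?thesis using kl(1) by (simp add: sum.delta)
    next
      case False
      have "(\<Sum>i<m. \<Sum>j<m. ennreal ((f (\<rho> i, \<rho> j))\<^sup>2) * indicator (C i j) p) = 0"
      proof (intro sum.neutral ballI)
        fix i j assume "i \<in> {..<m}" "j \<in> {..<m}"
        then have "p \<notin> C i j" using False by blast
        then show "ennreal ((f (\<rho> i, \<rho> j))\<^sup>2) * indicator (C i j) p = 0" by simp
      qed
      then show ?thesis by simp
    qed
  qed
  finally show ?thesis .
qed

section \<open>Double integrals of step kernels\<close>

lemma chaos_event_measurable:
  "{w \<in> space (PiM {..<n} (\<lambda>_. borel)). \<exists>m\<le>n. x < chaos b m w} \<in> sets (PiM {..<n} (\<lambda>_. borel))"
proof -
  have "Measurable.pred (PiM {..<n} (\<lambda>_. borel)) (\<lambda>w. x < chaos b i w)" if "i \<in> {..n}" for i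
  proof -
    have [measurable]: "chaos b i \<in> borel_measurable (PiM {..<n} (\<lambda>_. borel))"
      using that by (simp add: borel_measurable_chaos)
    show ?thesis by measurable
  qed
  then have "Measurable.pred (PiM {..<n} (\<lambda>_. borel)) (\<lambda>w. \<exists>m\<in>{..n}. x < chaos b m w)"
    by (intro pred_intros_finite(4)) auto
  then show ?thesis
    by (simp only: pred_def Bex_def atMost_iff)
qed

lemma chaos_restrict: "r \<le> m \<Longrightarrow> chaos b r (\<lambda>i\<in>{..<m}. X i) = chaos b r X"
  by (simp add: chaos_def predictable_coeff_def)

context brownian_motion
begin

lemma random_variable_quad_sum:
  assumes "subdivision T m \<rho>" "r \<le> m"
  shows "quad_sum B \<rho> f r \<in> borel_measurable M"
proof -
  have [measurable]: "B (\<rho> i) \<in> borel_measurable M" if "i \<le> m" for i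
    using subdivision_bounds[OF assms(1) that] by (intro random_variable) simp
  show ?thesis
    unfolding quad_sum_def using assms(2)
    by (intro borel_measurable_sum borel_measurable_times borel_measurable_diff borel_measurable_const)
      auto
qed

text \<open>Independence gives the product form and normality the factors. This lemma carries the
  estimates on \<open>gauss_product\<close> over to the Brownian motion.\<close>

lemma distr_increments:
  assumes \<rho>: "subdivision T m \<rho>"
    and v: "\<And>i. i < m \<Longrightarrow> v i = \<rho> (Suc i) - \<rho> i"
  shows "distr M (PiM {..<m} (\<lambda>_. borel)) (\<lambda>\<omega>. \<lambda>i\<in>{..<m}. B (\<rho> (Suc i)) \<omega> - B (\<rho> i) \<omega>)
    = gauss_product m v"
proof -
  \<comment> \<open>The criterion for independence by product laws is used for a nonempty index
    set.\<close>
  have "m \<noteq> 0" using \<rho> T_pos by (cases m) (auto simp: subdivision_def)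
  have incr: "\<rho> i < \<rho> (Suc i)" "0 \<le> \<rho> i" "\<rho> (Suc i) \<le> T" if "i < m" for i
    using \<rho> subdivision_bounds[OF \<rho>] that by (auto simp: subdivision_def)
  have rv: "(\<lambda>\<omega>. B (\<rho> (Suc i)) \<omega> - B (\<rho> i) \<omega>) \<in> borel_measurable M" if "i < m" for i
    using incr[OF that] by (intro borel_measurable_diff random_variable) auto
  have "indep_vars (\<lambda>_. borel) (\<lambda>i \<omega>. B (\<rho> (Suc i)) \<omega> - B (\<rho> i) \<omega>) {..<m}"
    using incr subdivision_bounds[OF \<rho>] by (intro indep_increments) (auto intro: less_imp_le)
  then have "distr M (PiM {..<m} (\<lambda>_. borel)) (\<lambda>\<omega>. \<lambda>i\<in>{..<m}. B (\<rho> (Suc i)) \<omega> - B (\<rho> i) \<omega>)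
      = PiM {..<m} (\<lambda>i. distr M borel (\<lambda>\<omega>. B (\<rho> (Suc i)) \<omega> - B (\<rho> i) \<omega>))"
    using \<open>m \<noteq> 0\<close> rv by (subst (asm) indep_vars_iff_distr_eq_PiM') auto
  also have "\<dots> = gauss_product m v"
  proof (rule PiM_cong[OF refl])
    fix i assume "i \<in> {..<m}"
    then have i: "i < m" by simp
    have "distributed M lborel (\<lambda>\<omega>. B (\<rho> (Suc i)) \<omega> - B (\<rho> i) \<omega>) (normal_density 0 (sqrt (v i)))"
      unfolding v[OF i] using incr[OF i] by (intro normal_increments)
    then have "distr M lborel (\<lambda>\<omega>. B (\<rho> (Suc i)) \<omega> - B (\<rho> i) \<omega>) = centered_normal (v i)"
      by (rule distributed_distr_eq_density)
    moreover have "distr M lborel (\<lambda>\<omega>. B (\<rho> (Suc i)) \<omega> - B (\<rho> i) \<omega>)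
        = distr M borel (\<lambda>\<omega>. B (\<rho> (Suc i)) \<omega> - B (\<rho> i) \<omega>)"
      by (intro distr_cong) simp_all
    ultimately show "distr M borel (\<lambda>\<omega>. B (\<rho> (Suc i)) \<omega> - B (\<rho> i) \<omega>) = centered_normal (v i)"
      by simp
  qed
  finally show ?thesis .
qed

text \<open>The Gaussian maximal inequality pulled back along the vector of increments. Here
  \<sigma> is any upper bound for the norm, so that it applies both to kernels near \<open>g\<close>
  and to small differences.\<close>

lemma prob_quad_sum_maximal:
  assumes \<rho>: "subdivision T m \<rho>" and f: "cell_constant m \<rho> f"
    and diag: "\<And>i. i < m \<Longrightarrow> f (\<rho> i, \<rho> i) = 0"
    and energy: "(\<integral>\<^sup>+p. ennreal ((f p)\<^sup>2) \<partial>square_measure T) \<le> ennreal (\<sigma>\<^sup>2)"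
    and "0 < \<sigma>" "0 < x"
  shows "{\<omega> \<in> space M. \<exists>r\<le>m. x < quad_sum B \<rho> f r \<omega>} \<in> events" (is "?A \<in> _")
    and "prob {\<omega> \<in> space M. \<exists>r\<le>m. x < quad_sum B \<rho> f r \<omega>} \<le> 2 * exp (- tail_exponent x \<sigma>)"
proof -
  \<comment> \<open>The value 1 beyond the last cell only secures positivity at all indices, as the
    product measure lemmas require.\<close>
  define v where "v i = (if i < m then \<rho> (Suc i) - \<rho> i else 1)" for i
  define X where "X \<omega> i = B (\<rho> (Suc i)) \<omega> - B (\<rho> i) \<omega>" for \<omega> i
  define Z where "Z \<omega> = (\<lambda>i\<in>{..<m}. X \<omega> i)" for \<omega>
  define b where "b k j = f (\<rho> k, \<rho> j) + f (\<rho> j, \<rho> k)" for k j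
  let ?P = "PiM {..<m} (\<lambda>_. borel :: real measure)"
  let ?E = "{w \<in> space ?P. \<exists>r\<le>m. x < chaos b r w}"
  have v: "0 < v i" for i using \<rho> by (simp add: v_def subdivision_def)
  have distr: "distr M ?P Z = gauss_product m v"
    unfolding Z_def X_def by (rule distr_increments[OF \<rho>]) (simp add: v_def)
  have Z: "Z \<in> measurable M ?P"
  proof -
    have "(\<lambda>\<omega>. X \<omega> i) \<in> borel_measurable M" if "i \<in> {..<m}" for i
      unfolding X_def using subdivision_bounds[OF \<rho>, of i] subdivision_bounds[OF \<rho>, of "Suc i"] that
      by (intro borel_measurable_diff random_variable) auto
    then show ?thesis unfolding Z_def by (rule measurable_restrict)
  qed
  have quad: "quad_sum B \<rho> f r \<omega> = chaos b r (Z \<omega>)" if "r \<le> m" for r \<omega>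
  proof -
    have "b = (\<lambda>k j. f (\<rho> k, \<rho> j) + f (\<rho> j, \<rho> k))" by (intro ext) (simp add: b_def)
    then show ?thesis
      using quadratic_form_eq_chaos[of r "\<lambda>i j. f (\<rho> i, \<rho> j)" "X \<omega>"] diag that
      by (simp add: quad_sum_def Z_def chaos_restrict flip: X_def)
  qed
  have A_eq: "?A = Z -` ?E \<inter> space M"
  proof -
    have "(\<exists>r\<le>m. x < quad_sum B \<rho> f r \<omega>) \<longleftrightarrow> (\<exists>r\<le>m. x < chaos b r (Z \<omega>))" for \<omega>
      using quad by metis
    then show ?thesis using measurable_space[OF Z] by blast
  qed
  show A: "?A \<in> events"
    unfolding A_eq by (rule measurable_sets[OF Z chaos_event_measurable])
  have "ennreal (\<Sum>i<m. \<Sum>j<m. (f (\<rho> i, \<rho> j))\<^sup>2 * v i * v j) \<le> ennreal (\<sigma>\<^sup>2)"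
  proof -
    have "(\<Sum>i<m. \<Sum>j<m. (f (\<rho> i, \<rho> j))\<^sup>2 * v i * v j)
        = (\<Sum>i<m. \<Sum>j<m. (f (\<rho> i, \<rho> j))\<^sup>2 * (\<rho> (Suc i) - \<rho> i) * (\<rho> (Suc j) - \<rho> j))"
      by (intro sum.cong refl) (simp add: v_def)
    then show ?thesis
      using order_trans[OF cell_constant_energy_le[OF \<rho> f] energy] by (simp only:)
  qed
  then have "(\<Sum>i<m. \<Sum>j<m. (f (\<rho> i, \<rho> j))\<^sup>2 * v i * v j) \<le> \<sigma>\<^sup>2"
    by (simp add: ennreal_le_iff)
  with bracket_mean_symmetrized_le[where v = v and a = "\<lambda>i j. f (\<rho> i, \<rho> j)" and n = m, OF v]
  have V: "bracket_mean b v m \<le> 2 * \<sigma>\<^sup>2"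
    unfolding b_def by simp
  have "emeasure M ?A = emeasure (distr M ?P Z) ?E"
    unfolding A_eq by (rule emeasure_distr[OF Z chaos_event_measurable, symmetric])
  also have "\<dots> = emeasure (gauss_product m v) {w \<in> space (gauss_product m v). \<exists>r\<le>m. x < chaos b r w}"
    by (simp only: distr space_gauss_product)
  also have "\<dots> \<le> ennreal (2 * exp (- tail_exponent x \<sigma>))"
    by (rule emeasure_chaos_maximal[OF v V \<open>0 < \<sigma>\<close> \<open>0 < x\<close>])
  finally have "ennreal (prob ?A) \<le> ennreal (2 * exp (- tail_exponent x \<sigma>))"
    by (simp only: emeasure_eq_measure)
  then show "prob ?A \<le> 2 * exp (- tail_exponent x \<sigma>)"
    by (subst (asm) ennreal_le_iff) simp_all
qed

text \<open>Applied to \<open>f\<close> and \<open>- f\<close>. It plays the part of the Ito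
  isometry in the approximation: a kernel of small norm has a double integral that is small in
  probability.\<close>

lemma prob_quad_sum_abs:
  assumes \<rho>: "subdivision T m \<rho>" and f: "cell_constant m \<rho> f"
    and diag: "\<And>i. i < m \<Longrightarrow> f (\<rho> i, \<rho> i) = 0"
    and energy: "(\<integral>\<^sup>+p. ennreal ((f p)\<^sup>2) \<partial>square_measure T) \<le> ennreal (\<sigma>\<^sup>2)"
    and "0 < \<sigma>" "0 < x"
  shows "prob {\<omega> \<in> space M. x < \<bar>quad_sum B \<rho> f m \<omega>\<bar>} \<le> 4 * exp (- tail_exponent x \<sigma>)"
proof -
  let ?A = "\<lambda>h. {\<omega> \<in> space M. \<exists>r\<le>m. x < quad_sum B \<rho> h r \<omega>}"
  note plus = prob_quad_sum_maximal[OF \<rho> f diag energy \<open>0 < \<sigma>\<close> \<open>0 < x\<close>]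
  have minus: "?A (\<lambda>p. - f p) \<in> events" "prob (?A (\<lambda>p. - f p)) \<le> 2 * exp (- tail_exponent x \<sigma>)"
    using diag energy
    by (intro prob_quad_sum_maximal[OF \<rho> cell_constant_uminus[OF f] _ _ \<open>0 < \<sigma>\<close> \<open>0 < x\<close>]; simp)+
  have sub: "{\<omega> \<in> space M. x < \<bar>quad_sum B \<rho> f m \<omega>\<bar>} \<subseteq> ?A f \<union> ?A (\<lambda>p. - f p)"
  proof
    fix \<omega> assume "\<omega> \<in> {\<omega> \<in> space M. x < \<bar>quad_sum B \<rho> f m \<omega>\<bar>}"
    then have \<omega>: "\<omega> \<in> space M" and "x < quad_sum B \<rho> f m \<omega> \<or> x < - quad_sum B \<rho> f m \<omega>"
      by auto
    then have "x < quad_sum B \<rho> f m \<omega> \<or> x < quad_sum B \<rho> (\<lambda>p. - f p) m \<omega>"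
      by (simp only: quad_sum_uminus)
    then show "\<omega> \<in> ?A f \<union> ?A (\<lambda>p. - f p)" using \<omega> by blast
  qed
  have "prob {\<omega> \<in> space M. x < \<bar>quad_sum B \<rho> f m \<omega>\<bar>} \<le> prob (?A f \<union> ?A (\<lambda>p. - f p))"
    by (rule finite_measure_mono[OF sub sets.Un[OF plus(1) minus(1)]])
  also have "\<dots> \<le> prob (?A f) + prob (?A (\<lambda>p. - f p))"
    by (rule measure_Un_le[OF plus(1) minus(1)])
  also have "\<dots> \<le> 4 * exp (- tail_exponent x \<sigma>)"
    using plus(2) minus(2) by linarith
  finally show ?thesis .
qed

lemma random_variable_step_double_integral:
  assumes "subdivision T n \<tau>"
  shows "step_double_integral B n \<tau> a \<in> borel_measurable M"
proof -
  have "step_double_integral B n \<tau> a = quad_sum B \<tau> (step_kernel n \<tau> a) n"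
    by (intro ext) (simp only: quad_sum_step_kernel[OF assms assms order_refl])
  then show ?thesis
    using random_variable_quad_sum[OF assms order_refl, of "step_kernel n \<tau> a"] by (simp only:)
qed

text \<open>Chebyshev's inequality.\<close>

lemma prob_deviation_le:
  assumes [measurable]: "Z \<in> borel_measurable M"
    and Z: "(\<integral>\<^sup>+\<omega>. ennreal ((Z \<omega>)\<^sup>2) \<partial>M) \<le> ennreal (\<delta> * \<epsilon>\<^sup>2)" and "0 < \<epsilon>" "0 \<le> \<delta>"
  shows "prob {\<omega> \<in> space M. \<epsilon> \<le> \<bar>Z \<omega>\<bar>} \<le> \<delta>"
proof -
  have "ennreal (prob {\<omega> \<in> space M. \<epsilon> \<le> \<bar>Z \<omega>\<bar>}) = emeasure M {\<omega> \<in> space M. \<epsilon> \<le> \<bar>Z \<omega>\<bar>}"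
    by (simp add: emeasure_eq_measure)
  also have "\<dots> = (\<integral>\<^sup>+\<omega>. indicator {\<omega> \<in> space M. \<epsilon> \<le> \<bar>Z \<omega>\<bar>} \<omega> \<partial>M)"
    by (rule nn_integral_indicator[symmetric]) measurable
  also have "\<dots> \<le> (\<integral>\<^sup>+\<omega>. ennreal (1 / \<epsilon>\<^sup>2) * ennreal ((Z \<omega>)\<^sup>2) \<partial>M)"
  proof (intro nn_integral_mono)
    fix \<omega>
    show "indicator {\<omega> \<in> space M. \<epsilon> \<le> \<bar>Z \<omega>\<bar>} \<omega> \<le> ennreal (1 / \<epsilon>\<^sup>2) * ennreal ((Z \<omega>)\<^sup>2)"
    proof (cases "\<omega> \<in> {\<omega> \<in> space M. \<epsilon> \<le> \<bar>Z \<omega>\<bar>}")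
      case True
      then have "\<epsilon>\<^sup>2 \<le> (Z \<omega>)\<^sup>2" using \<open>0 < \<epsilon>\<close> by (simp flip: abs_le_square_iff)
      then have "ennreal 1 \<le> ennreal (1 / \<epsilon>\<^sup>2 * (Z \<omega>)\<^sup>2)"
        using \<open>0 < \<epsilon>\<close> by (intro ennreal_leI) simp
      also have "\<dots> = ennreal (1 / \<epsilon>\<^sup>2) * ennreal ((Z \<omega>)\<^sup>2)"
        by (rule ennreal_mult) simp_all
      finally show ?thesis by (simp only: indicator_simps(1)[OF True] ennreal_1)
    qed simp
  qed
  also have "\<dots> = ennreal (1 / \<epsilon>\<^sup>2) * (\<integral>\<^sup>+\<omega>. ennreal ((Z \<omega>)\<^sup>2) \<partial>M)"
    by (rule nn_integral_cmult) measurable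
  also have "\<dots> \<le> ennreal (1 / \<epsilon>\<^sup>2) * ennreal (\<delta> * \<epsilon>\<^sup>2)"
    using Z by (rule mult_left_mono) simp
  also have "\<dots> = ennreal \<delta>"
    using \<open>0 < \<epsilon>\<close> \<open>0 \<le> \<delta>\<close> by (simp flip: ennreal_mult)
  finally show ?thesis using \<open>0 \<le> \<delta>\<close> by simp
qed

end

text \<open>Both limits in the definition run along the same sequence, so a single late index serves
  for the kernels and for the integrals.\<close>

lemma double_wiener_ito_approximation:
  assumes "is_double_wiener_ito_integral M T B f X" and "0 < \<eta>"
  obtains n \<tau> a where "subdivision T n \<tau>" "\<forall>i<n. a i i = 0"
    "(\<integral>\<^sup>+p. ennreal ((f p - step_kernel n \<tau> a p)\<^sup>2) \<partial>square_measure T) \<le> ennreal \<eta>"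
    "(\<integral>\<^sup>+\<omega>. ennreal ((X \<omega> - step_double_integral B n \<tau> a \<omega>)\<^sup>2) \<partial>M) \<le> ennreal \<eta>"
proof -
  obtain n \<tau> a where na: "\<forall>k. subdivision T (n k) (\<tau> k) \<and> (\<forall>i < n k. a k i i = 0)"
    and lim: "(\<lambda>k. \<integral>\<^sup>+p. ennreal ((f p - step_kernel (n k) (\<tau> k) (a k) p)\<^sup>2) \<partial>square_measure T)
          \<longlonglongrightarrow> 0"
        "(\<lambda>k. \<integral>\<^sup>+\<omega>. ennreal ((X \<omega> - step_double_integral B (n k) (\<tau> k) (a k) \<omega>)\<^sup>2) \<partial>M)
          \<longlonglongrightarrow> 0"
    using assms(1) unfolding is_double_wiener_ito_integral_def by blast
  have "0 < ennreal \<eta>" using assms(2) by simp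
  then have "\<forall>\<^sub>F k in sequentially.
      (\<integral>\<^sup>+p. ennreal ((f p - step_kernel (n k) (\<tau> k) (a k) p)\<^sup>2) \<partial>square_measure T) < ennreal \<eta> \<and>
      (\<integral>\<^sup>+\<omega>. ennreal ((X \<omega> - step_double_integral B (n k) (\<tau> k) (a k) \<omega>)\<^sup>2) \<partial>M) < ennreal \<eta>"
    using order_tendstoD(2)[OF lim(1)] order_tendstoD(2)[OF lim(2)] by (intro eventually_conj)
  then obtain k where
      "(\<integral>\<^sup>+p. ennreal ((f p - step_kernel (n k) (\<tau> k) (a k) p)\<^sup>2) \<partial>square_measure T) < ennreal \<eta> \<and>
      (\<integral>\<^sup>+\<omega>. ennreal ((X \<omega> - step_double_integral B (n k) (\<tau> k) (a k) \<omega>)\<^sup>2) \<partial>M) < ennreal \<eta>"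
    using eventually_happens'[OF sequentially_bot] by blast
  then show thesis using na by (intro that[of "n k" "\<tau> k" "a k"]) (auto intro: less_imp_le)
qed

section \<open>Tools for comparing kernels in mean square\<close>

lemma borel_measurable_step_kernel:
  "step_kernel n \<tau> a \<in> borel_measurable (square_measure T)"
proof -
  have "step_kernel n \<tau> a \<in> borel_measurable borel"
    unfolding step_kernel_def
    by (intro borel_measurable_sum borel_measurable_times borel_measurable_const
        borel_measurable_indicator borel_Times) simp_all
  then have "step_kernel n \<tau> a \<in> borel_measurable lebesgue"
    by (simp add: measurable_completion)
  then show ?thesis by (rule measurable_restrict_space1)
qed

text \<open>The two lines are hyperplanes, hence negligible. Off them, the half-open square of
  \<open>restrict_kernel\<close> agrees with the closed one on the domain.\<close>

lemma AE_square_measure_off_lines: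
  "AE p in square_measure T. fst p \<noteq> t \<and> snd p \<noteq> (t::real)"
proof -
  have "negligible {p :: real \<times> real. (1, 0) \<bullet> p = t}" "negligible {p :: real \<times> real. (0, 1) \<bullet> p = t}"
    by (intro negligible_hyperplane; simp add: zero_prod_def)+
  then have "{p :: real \<times> real. fst p = t} \<union> {p. snd p = t} \<in> null_sets lebesgue"
    by (simp add: inner_prod_def negligible_iff_null_sets[symmetric] negligible_Un)
  then have "AE p in lebesgue. p \<notin> {p :: real \<times> real. fst p = t} \<union> {p. snd p = t}"
    by (rule AE_not_in)
  then have "AE p in lebesgue. fst p \<noteq> t \<and> snd p \<noteq> t"
    by simp
  then show ?thesis
    by (subst AE_restrict_space_iff) (auto simp: borel_Times elim: AE_mp)
qed

lemma power2_triangle: "((a::real) - c)\<^sup>2 \<le> 2 * (a - b)\<^sup>2 + 2 * (b - c)\<^sup>2"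
  using zero_le_power2[of "a - 2 * b + c"] by (simp add: power2_eq_square algebra_simps)

text \<open>The difference of the two sides is a perfect square divided by \<epsilon> * \<sigma>.
  The weights are chosen so that inserting norms \<sigma> and \<epsilon> gives exactly
  \<open>(\<sigma> + \<epsilon>)\<^sup>2\<close>, as in Minkowski's inequality.\<close>

lemma power2_sum_le_weighted:
  assumes "0 < (\<sigma>::real)" "0 < \<epsilon>"
  shows "a\<^sup>2 \<le> (1 + \<epsilon> / \<sigma>) * b\<^sup>2 + (1 + \<sigma> / \<epsilon>) * (b - a)\<^sup>2"
proof -
  have "(1 + \<epsilon> / \<sigma>) * b\<^sup>2 + (1 + \<sigma> / \<epsilon>) * (b - a)\<^sup>2 - a\<^sup>2 = (\<epsilon> * b + \<sigma> * (b - a))\<^sup>2 / (\<epsilon> * \<sigma>)"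
    using assms by (simp add: field_simps power2_eq_square)
  also have "0 \<le> \<dots>" using assms by simp
  finally show ?thesis by simp
qed

section \<open>Passage to the limit\<close>

text \<open>For a fixed level the denominator of the exponent tends to 0 with \<sigma>, so the
  exponent tends to infinity.\<close>

lemma tail_exponent_small_scale:
  assumes "0 < x" "0 < \<delta>"
  obtains \<sigma> where "0 < \<sigma>" "4 * exp (- tail_exponent x \<sigma>) \<le> \<delta>"
proof -
  have "((\<lambda>\<sigma>. (\<sigma> + sqrt (\<sigma>\<^sup>2 + sqrt 8 * \<sigma> * x))\<^sup>2) \<longlongrightarrow> 0) (at_right 0)"
    by (auto intro!: tendsto_eq_intros)
  moreover have "\<forall>\<^sub>F \<sigma> in at_right 0. 0 < (\<sigma> + sqrt (\<sigma>\<^sup>2 + sqrt 8 * \<sigma> * x))\<^sup>2"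
    using eventually_at_right_less[of "0 :: real"]
  proof eventually_elim
    fix \<sigma> :: real assume "0 < \<sigma>"
    then have "0 < \<sigma> + sqrt (\<sigma>\<^sup>2 + sqrt 8 * \<sigma> * x)"
      using \<open>0 < x\<close> by (intro add_pos_nonneg) simp_all
    then show "0 < (\<sigma> + sqrt (\<sigma>\<^sup>2 + sqrt 8 * \<sigma> * x))\<^sup>2"
      by (rule zero_less_power)
  qed
  ultimately have "filterlim (\<lambda>\<sigma>. x\<^sup>2 / (\<sigma> + sqrt (\<sigma>\<^sup>2 + sqrt 8 * \<sigma> * x))\<^sup>2) at_top (at_right 0)"
    using \<open>0 < x\<close> by (intro LIM_at_top_divide[OF tendsto_const]) auto
  then have "((\<lambda>\<sigma>. 4 * exp (- tail_exponent x \<sigma>)) \<longlongrightarrow> 4 * 0) (at_right 0)"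
    unfolding tail_exponent_def
    by (intro tendsto_intros filterlim_compose[OF exp_at_bot]) (simp add: filterlim_uminus_at_bot)
  then have "\<forall>\<^sub>F \<sigma> in at_right 0. 4 * exp (- tail_exponent x \<sigma>) < \<delta>"
    using \<open>0 < \<delta>\<close> by (intro order_tendstoD(2)) auto
  then have "\<forall>\<^sub>F \<sigma> in at_right 0. 0 < \<sigma> \<and> 4 * exp (- tail_exponent x \<sigma>) < \<delta>"
    using eventually_at_right_less[of "0 :: real"] by eventually_elim simp
  then obtain \<sigma> where "0 < \<sigma> \<and> 4 * exp (- tail_exponent x \<sigma>) < \<delta>"
    using eventually_happens'[OF trivial_limit_at_right_real] by blast
  then show thesis by (intro that[of \<sigma>]) auto
qed

lemma tendsto_tail_bound:
  assumes "0 < \<sigma>" "0 < x"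
  shows "((\<lambda>\<epsilon>. 2 * exp (- tail_exponent (x - 2 * \<epsilon>) (\<sigma> + \<epsilon>))) \<longlongrightarrow> 2 * exp (- tail_exponent x \<sigma>)) (at_right 0)"
proof -
  have "0 < \<sigma> + sqrt (\<sigma>\<^sup>2 + sqrt 8 * \<sigma> * x)"
    using assms by (intro add_pos_nonneg) auto
  then show ?thesis
    unfolding tail_exponent_def by (auto intro!: tendsto_eq_intros)
qed

lemma nn_integral_square_eq_L2_norm:
  assumes "square_integrable_on_square T g"
  shows "(\<integral>\<^sup>+p. ennreal ((g p)\<^sup>2) \<partial>square_measure T) = ennreal ((L2_norm_square T g)\<^sup>2)"
  using assms unfolding square_integrable_on_square_def L2_norm_square_def
  by (simp add: nn_integral_eq_integral)

lemma energy_perturbation: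
  assumes g: "g \<in> borel_measurable (square_measure T)"
    and gs: "(\<integral>\<^sup>+p. ennreal ((g p)\<^sup>2) \<partial>square_measure T) = ennreal (\<sigma>\<^sup>2)"
    and f: "f \<in> borel_measurable (square_measure T)"
    and fg: "(\<integral>\<^sup>+p. ennreal ((g p - f p)\<^sup>2) \<partial>square_measure T) \<le> ennreal (\<epsilon>\<^sup>2)"
    and "0 < \<sigma>" "0 < \<epsilon>"
  shows "(\<integral>\<^sup>+p. ennreal ((f p)\<^sup>2) \<partial>square_measure T) \<le> ennreal ((\<sigma> + \<epsilon>)\<^sup>2)"
proof -
  note [measurable] = f g
  have "(\<integral>\<^sup>+p. ennreal ((f p)\<^sup>2) \<partial>square_measure T)
      \<le> (\<integral>\<^sup>+p. ennreal (1 + \<epsilon> / \<sigma>) * ennreal ((g p)\<^sup>2)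
        + ennreal (1 + \<sigma> / \<epsilon>) * ennreal ((g p - f p)\<^sup>2) \<partial>square_measure T)"
  proof (rule nn_integral_mono)
    fix p
    have "ennreal ((f p)\<^sup>2) \<le> ennreal ((1 + \<epsilon> / \<sigma>) * (g p)\<^sup>2 + (1 + \<sigma> / \<epsilon>) * (g p - f p)\<^sup>2)"
      by (intro ennreal_leI power2_sum_le_weighted assms)
    also have "\<dots> = ennreal (1 + \<epsilon> / \<sigma>) * ennreal ((g p)\<^sup>2) + ennreal (1 + \<sigma> / \<epsilon>) * ennreal ((g p - f p)\<^sup>2)"
      using \<open>0 < \<sigma>\<close> \<open>0 < \<epsilon>\<close> by (simp add: ennreal_plus ennreal_mult' del: ennreal_plus[symmetric])
    finally show "ennreal ((f p)\<^sup>2) \<le> \<dots>" .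
  qed
  also have "\<dots> = ennreal (1 + \<epsilon> / \<sigma>) * (\<integral>\<^sup>+p. ennreal ((g p)\<^sup>2) \<partial>square_measure T)
      + ennreal (1 + \<sigma> / \<epsilon>) * (\<integral>\<^sup>+p. ennreal ((g p - f p)\<^sup>2) \<partial>square_measure T)"
    by (subst nn_integral_add) (auto simp: nn_integral_cmult)
  also have "\<dots> \<le> ennreal (1 + \<epsilon> / \<sigma>) * ennreal (\<sigma>\<^sup>2) + ennreal (1 + \<sigma> / \<epsilon>) * ennreal (\<epsilon>\<^sup>2)"
    unfolding gs using fg by (intro add_mono mult_left_mono order_refl) simp_all
  also have "\<dots> = ennreal ((1 + \<epsilon> / \<sigma>) * \<sigma>\<^sup>2 + (1 + \<sigma> / \<epsilon>) * \<epsilon>\<^sup>2)"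
    using \<open>0 < \<sigma>\<close> \<open>0 < \<epsilon>\<close> by (simp flip: ennreal_mult ennreal_plus)
  also have "(1 + \<epsilon> / \<sigma>) * \<sigma>\<^sup>2 + (1 + \<sigma> / \<epsilon>) * \<epsilon>\<^sup>2 = (\<sigma> + \<epsilon>)\<^sup>2"
    using \<open>0 < \<sigma>\<close> \<open>0 < \<epsilon>\<close> by (simp add: field_simps power2_eq_square)
  finally show ?thesis .
qed

text \<open>Cutting off by a square does not increase distances, so the restriction of
  \<open>f\<close> is as close to the restriction of \<open>g\<close> as \<open>f\<close> is to
  \<open>g\<close>. The factor 4 comes from squaring the triangle inequality.\<close>

lemma restrict_kernel_distance:
  assumes g: "g \<in> borel_measurable (square_measure T)"
    and f: "f \<in> borel_measurable (square_measure T)"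
    and h: "h \<in> borel_measurable (square_measure T)"
    and fg: "(\<integral>\<^sup>+p. ennreal ((g p - f p)\<^sup>2) \<partial>square_measure T) \<le> ennreal \<eta>"
    and hg: "(\<integral>\<^sup>+p. ennreal ((indicator ({0..t} \<times> {0..t}) p * g p - h p)\<^sup>2) \<partial>square_measure T) \<le> ennreal \<eta>"
    and "0 \<le> \<eta>"
  shows "(\<integral>\<^sup>+p. ennreal ((restrict_kernel t f p - h p)\<^sup>2) \<partial>square_measure T) \<le> ennreal (4 * \<eta>)"
proof -
  note [measurable] = f g h
  have I [measurable]: "(\<lambda>p. indicator ({0..t} \<times> {0..t}) p :: real) \<in> borel_measurable (square_measure T)"
  proof -
    have "(\<lambda>p. indicator ({0..t} \<times> {0..t}) p :: real) \<in> borel_measurable lebesgue"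
      by (intro measurable_completion borel_measurable_indicator) (simp add: borel_Times)
    then show ?thesis by (rule measurable_restrict_space1)
  qed
  let ?g = "\<lambda>p. indicator ({0..t} \<times> {0..t}) p * g p"
  have "(\<integral>\<^sup>+p. ennreal ((restrict_kernel t f p - h p)\<^sup>2) \<partial>square_measure T)
      \<le> (\<integral>\<^sup>+p. ennreal 2 * ennreal ((g p - f p)\<^sup>2) + ennreal 2 * ennreal ((?g p - h p)\<^sup>2) \<partial>square_measure T)"
  proof (rule nn_integral_mono_AE, use AE_square_measure_off_lines[of t T] in eventually_elim)
    fix p :: "real \<times> real" assume "fst p \<noteq> t \<and> snd p \<noteq> t"
    then have "restrict_kernel t f p = indicator ({0..t} \<times> {0..t}) p * f p"
      by (cases p) (auto simp: restrict_kernel_def indicator_def)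
    then have "(restrict_kernel t f p - ?g p)\<^sup>2 \<le> (g p - f p)\<^sup>2"
      by (simp add: indicator_def power2_commute)
    then have "(restrict_kernel t f p - h p)\<^sup>2 \<le> 2 * (g p - f p)\<^sup>2 + 2 * (?g p - h p)\<^sup>2"
      using power2_triangle[of "restrict_kernel t f p" "h p" "?g p"] by linarith
    then have "ennreal ((restrict_kernel t f p - h p)\<^sup>2) \<le> ennreal (2 * (g p - f p)\<^sup>2 + 2 * (?g p - h p)\<^sup>2)"
      by (rule ennreal_leI)
    also have "\<dots> = ennreal 2 * ennreal ((g p - f p)\<^sup>2) + ennreal 2 * ennreal ((?g p - h p)\<^sup>2)"
      by (subst ennreal_plus) (simp_all only: ennreal_mult zero_le_power2 zero_le_numeral mult_nonneg_nonneg)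
    finally show "ennreal ((restrict_kernel t f p - h p)\<^sup>2)
      \<le> ennreal 2 * ennreal ((g p - f p)\<^sup>2) + ennreal 2 * ennreal ((?g p - h p)\<^sup>2)" .
  qed
  also have "\<dots> = ennreal 2 * (\<integral>\<^sup>+p. ennreal ((g p - f p)\<^sup>2) \<partial>square_measure T)
      + ennreal 2 * (\<integral>\<^sup>+p. ennreal ((?g p - h p)\<^sup>2) \<partial>square_measure T)"
    by (subst nn_integral_add) (auto simp: nn_integral_cmult)
  also have "\<dots> \<le> ennreal 2 * ennreal \<eta> + ennreal 2 * ennreal \<eta>"
    using fg hg by (intro add_mono mult_left_mono) simp_all
  also have "\<dots> = ennreal (2 * \<eta> + 2 * \<eta>)"
    using \<open>0 \<le> \<eta>\<close> by (subst ennreal_plus) (simp_all only: ennreal_mult zero_le_numeral mult_nonneg_nonneg)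
  finally show ?thesis by simp
qed

section \<open>From finitely many times to the supremum\<close>

context brownian_motion
begin

text \<open>Each \<open>Y t\<close> comes with step kernels of its own, unrelated for different
  \<open>t\<close>, whereas the maximal inequality needs a single kernel. One step kernel
  \<open>f\<close> near \<open>g\<close> is therefore fixed, and for every \<open>t\<close> its
  restriction is compared on a common refinement with the kernel \<open>h t\<close> that
  approximates \<open>Y t\<close>.\<close>

lemma prob_finite_maximal_approx:
  assumes g: "square_integrable_on_square T g"
    and Y: "\<And>t. t \<in> {0..T} \<Longrightarrow> is_double_wiener_ito_integral M T B
      (\<lambda>p. indicator ({0..t} \<times> {0..t}) p * g p) (Y t)"
    and F: "finite F" "F \<subseteq> {0..T}"
    and \<sigma>: "L2_norm_square T g = \<sigma>" "0 < \<sigma>" and \<epsilon>: "0 < \<epsilon>" "2 * \<epsilon> < x" and "0 < \<delta>"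
  shows "prob {\<omega> \<in> space M. \<exists>t\<in>F. x < Y t \<omega>}
    \<le> 2 * exp (- tail_exponent (x - 2 * \<epsilon>) (\<sigma> + \<epsilon>)) + real (card F) * (2 * \<delta>)"
proof -
  obtain s where s: "0 < s" "4 * exp (- tail_exponent \<epsilon> s) \<le> \<delta>"
    using tail_exponent_small_scale[OF \<epsilon>(1) \<open>0 < \<delta>\<close>] .
  \<comment> \<open>The three bounds serve, in this order, Chebyshev's inequality for
    \<open>E1\<close>, the energy of the differences \<open>d t\<close> for \<open>E2\<close>, and
    the energy of \<open>f\<close> for \<open>E0\<close>.\<close>
  define \<eta> where "\<eta> = min (\<delta> * \<epsilon>\<^sup>2) (min (s\<^sup>2 / 4) (\<epsilon>\<^sup>2))"
  have \<eta>: "0 < \<eta>" "\<eta> \<le> \<delta> * \<epsilon>\<^sup>2" "4 * \<eta> \<le> s\<^sup>2" "\<eta> \<le> \<epsilon>\<^sup>2"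
    using \<open>0 < \<delta>\<close> \<epsilon> s by (auto simp: \<eta>_def)
  have g_meas: "g \<in> borel_measurable (square_measure T)"
    using g by (simp add: square_integrable_on_square_def)
  have Y_meas: "Y t \<in> borel_measurable M" if "t \<in> F" for t
    using Y[of t] F that by (auto simp: is_double_wiener_ito_integral_def)

  have "T \<in> {0..T}" using T_pos by simp
  \<comment> \<open>The common kernel is taken from the approximation at time T, where the cut-off
    is 1 on the whole domain.\<close>
  obtain n0 \<tau>0 a0 where \<tau>0: "subdivision T n0 \<tau>0" and a0: "\<forall>i<n0. a0 i i = 0"
    and approx0: "(\<integral>\<^sup>+p. ennreal ((indicator ({0..T} \<times> {0..T}) p * g p - step_kernel n0 \<tau>0 a0 p)\<^sup>2)
      \<partial>square_measure T) \<le> ennreal \<eta>"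
    "(\<integral>\<^sup>+\<omega>. ennreal ((Y T \<omega> - step_double_integral B n0 \<tau>0 a0 \<omega>)\<^sup>2) \<partial>M) \<le> ennreal \<eta>"
    using double_wiener_ito_approximation[OF Y[OF \<open>T \<in> {0..T}\<close>] \<eta>(1)] .
  define f where "f = step_kernel n0 \<tau>0 a0"
  have f_meas: "f \<in> borel_measurable (square_measure T)"
    unfolding f_def by (rule borel_measurable_step_kernel)
  have fg: "(\<integral>\<^sup>+p. ennreal ((g p - f p)\<^sup>2) \<partial>square_measure T) \<le> ennreal \<eta>"
  proof -
    have "(\<integral>\<^sup>+p. ennreal ((g p - f p)\<^sup>2) \<partial>square_measure T)
        = (\<integral>\<^sup>+p. ennreal ((indicator ({0..T} \<times> {0..T}) p * g p - f p)\<^sup>2) \<partial>square_measure T)"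
      by (intro nn_integral_cong) (simp add: space_restrict_space)
    then show ?thesis using approx0 by (simp add: f_def)
  qed

  have "\<forall>t\<in>F. \<exists>c. subdivision T (fst c) (fst (snd c)) \<and> (\<forall>i<fst c. snd (snd c) i i = 0) \<and>
    (\<integral>\<^sup>+p. ennreal ((indicator ({0..t} \<times> {0..t}) p * g p
      - step_kernel (fst c) (fst (snd c)) (snd (snd c)) p)\<^sup>2) \<partial>square_measure T) \<le> ennreal \<eta> \<and>
    (\<integral>\<^sup>+\<omega>. ennreal ((Y t \<omega> - step_double_integral B (fst c) (fst (snd c)) (snd (snd c)) \<omega>)\<^sup>2) \<partial>M)
      \<le> ennreal \<eta>" (is "\<forall>t\<in>F. \<exists>c. ?approx t c")
  proof
    fix t assume "t \<in> F"
    then have "t \<in> {0..T}" using F by blast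
    obtain n \<tau> a where "subdivision T n \<tau>" "\<forall>i<n. a i i = 0"
      "(\<integral>\<^sup>+p. ennreal ((indicator ({0..t} \<times> {0..t}) p * g p - step_kernel n \<tau> a p)\<^sup>2) \<partial>square_measure T)
        \<le> ennreal \<eta>"
      "(\<integral>\<^sup>+\<omega>. ennreal ((Y t \<omega> - step_double_integral B n \<tau> a \<omega>)\<^sup>2) \<partial>M) \<le> ennreal \<eta>"
      using double_wiener_ito_approximation[OF Y[OF \<open>t \<in> {0..T}\<close>] \<eta>(1)] .
    then have "?approx t (n, \<tau>, a)" by simp
    then show "\<exists>c. ?approx t c" by blast
  qed
  then obtain c where c: "\<forall>t\<in>F. ?approx t (c t)" by (rule bchoice[THEN exE])
  define n where "n t = fst (c t)" for t
  define \<tau> where "\<tau> t = fst (snd (c t))" for t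
  define a where "a t = snd (snd (c t))" for t
  have \<tau>: "subdivision T (n t) (\<tau> t)" and a: "\<forall>i<n t. a t i i = 0"
    and hg: "(\<integral>\<^sup>+p. ennreal ((indicator ({0..t} \<times> {0..t}) p * g p
      - step_kernel (n t) (\<tau> t) (a t) p)\<^sup>2) \<partial>square_measure T) \<le> ennreal \<eta>"
    and YS: "(\<integral>\<^sup>+\<omega>. ennreal ((Y t \<omega> - step_double_integral B (n t) (\<tau> t) (a t) \<omega>)\<^sup>2) \<partial>M)
      \<le> ennreal \<eta>" if "t \<in> F" for t
    using c that unfolding n_def \<tau>_def a_def by blast+

  \<comment> \<open>The refinement also contains \<open>F\<close>, so that every time under
    consideration is a node and \<open>quad_sum\<close> can be evaluated there.\<close>
  define G where "G = \<tau>0 ` {..n0} \<union> (\<Union>t\<in>F. \<tau> t ` {..n t}) \<union> F"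
  have "finite G" using F by (simp add: G_def)
  have "G \<subseteq> {0..T}"
  proof -
    have "\<tau>0 ` {..n0} \<subseteq> {0..T}" using subdivision_bounds[OF \<tau>0] by auto
    moreover have "\<tau> t ` {..n t} \<subseteq> {0..T}" if "t \<in> F" for t
      using subdivision_bounds[OF \<tau>[OF that]] by auto
    ultimately show ?thesis using F unfolding G_def by blast
  qed
  moreover have "0 \<in> G" "T \<in> G"
  proof -
    have "\<tau>0 0 = 0" "\<tau>0 n0 = T" using \<tau>0 by (auto simp: subdivision_def)
    then have "0 \<in> \<tau>0 ` {..n0}" "T \<in> \<tau>0 ` {..n0}" by (force simp: image_iff)+
    then show "0 \<in> G" "T \<in> G" by (simp_all add: G_def)
  qed
  ultimately obtain m \<rho> where \<rho>: "subdivision T m \<rho>" and \<rho>_image: "\<rho> ` {..m} = G"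
    using subdivision_of_finite_set[OF \<open>finite G\<close>] by blast
  have sub0: "\<tau>0 ` {..n0} \<subseteq> \<rho> ` {..m}" and sub: "\<And>t. t \<in> F \<Longrightarrow> \<tau> t ` {..n t} \<subseteq> \<rho> ` {..m}"
    unfolding \<rho>_image G_def by blast+
  have "\<forall>t\<in>F. \<exists>r. r \<le> m \<and> t = \<rho> r"
    using \<rho>_image unfolding G_def by blast
  then obtain r where r: "\<forall>t\<in>F. r t \<le> m \<and> t = \<rho> (r t)" by (rule bchoice[THEN exE])

  define h where "h t = step_kernel (n t) (\<tau> t) (a t)" for t
  define d where "d t p = restrict_kernel t f p - h t p" for t p
  have f_const: "cell_constant m \<rho> f"
    unfolding f_def by (rule cell_constant_step_kernel[OF \<rho> sub0])
  have f_diag: "f (u, u) = 0" for u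
    unfolding f_def by (rule step_kernel_diagonal[OF \<tau>0 a0[rule_format]])
  have d_const: "cell_constant m \<rho> (d t)" if "t \<in> F" for t
  proof -
    have "cell_constant m \<rho> (restrict_kernel t f)"
      using cell_constant_restrict_kernel[OF \<rho> _ f_const, of "r t"] r that by simp
    moreover have "cell_constant m \<rho> (h t)"
      unfolding h_def by (rule cell_constant_step_kernel[OF \<rho> sub[OF that]])
    ultimately show ?thesis unfolding d_def by (rule cell_constant_diff)
  qed
  have d_diag: "d t (u, u) = 0" if "t \<in> F" for t u
  proof -
    have "h t (u, u) = 0"
      unfolding h_def using a[OF that] by (intro step_kernel_diagonal[OF \<tau>[OF that]]) blast
    then show ?thesis by (simp add: d_def restrict_kernel_def f_diag)
  qed
  have d_energy: "(\<integral>\<^sup>+p. ennreal ((d t p)\<^sup>2) \<partial>square_measure T) \<le> ennreal (s\<^sup>2)" if "t \<in> F" for t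
  proof -
    have "(\<integral>\<^sup>+p. ennreal ((d t p)\<^sup>2) \<partial>square_measure T) \<le> ennreal (4 * \<eta>)"
      unfolding d_def h_def using hg[OF that] \<eta>(1)
      by (intro restrict_kernel_distance[OF g_meas f_meas borel_measurable_step_kernel fg]) auto
    also have "\<dots> \<le> ennreal (s\<^sup>2)" using \<eta>(3) by (rule ennreal_leI)
    finally show ?thesis .
  qed
  have f_energy: "(\<integral>\<^sup>+p. ennreal ((f p)\<^sup>2) \<partial>square_measure T) \<le> ennreal ((\<sigma> + \<epsilon>)\<^sup>2)"
  proof (rule energy_perturbation[OF g_meas _ f_meas _ \<sigma>(2) \<epsilon>(1)])
    show "(\<integral>\<^sup>+p. ennreal ((g p)\<^sup>2) \<partial>square_measure T) = ennreal (\<sigma>\<^sup>2)"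
      using nn_integral_square_eq_L2_norm[OF g] \<sigma>(1) by simp
    show "(\<integral>\<^sup>+p. ennreal ((g p - f p)\<^sup>2) \<partial>square_measure T) \<le> ennreal (\<epsilon>\<^sup>2)"
      by (rule order_trans[OF fg ennreal_leI[OF \<eta>(4)]])
  qed

  define S where "S t = step_double_integral B (n t) (\<tau> t) (a t)" for t
  define E0 where "E0 = {\<omega> \<in> space M. \<exists>r\<le>m. x - 2 * \<epsilon> < quad_sum B \<rho> f r \<omega>}"
  define E1 where "E1 t = {\<omega> \<in> space M. \<epsilon> \<le> \<bar>Y t \<omega> - S t \<omega>\<bar>}" for t
  define E2 where "E2 t = {\<omega> \<in> space M. \<epsilon> < \<bar>quad_sum B \<rho> (d t) m \<omega>\<bar>}" for t
  have "0 < \<sigma> + \<epsilon>" "0 < x - 2 * \<epsilon>" using \<sigma> \<epsilon> by auto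
  note max = prob_quad_sum_maximal[OF \<rho> f_const f_diag f_energy this]
  have E0: "E0 \<in> events" "prob E0 \<le> 2 * exp (- tail_exponent (x - 2 * \<epsilon>) (\<sigma> + \<epsilon>))"
    unfolding E0_def by (rule max)+
  have E1: "E1 t \<in> events" "prob (E1 t) \<le> \<delta>" if "t \<in> F" for t
  proof -
    have [measurable]: "(\<lambda>\<omega>. Y t \<omega> - S t \<omega>) \<in> borel_measurable M"
      unfolding S_def
      by (intro borel_measurable_diff Y_meas random_variable_step_double_integral[OF \<tau>] that)
    show "E1 t \<in> events" unfolding E1_def by measurable
    show "prob (E1 t) \<le> \<delta>"
      unfolding E1_def
    proof (rule prob_deviation_le)
      show "(\<integral>\<^sup>+\<omega>. ennreal ((Y t \<omega> - S t \<omega>)\<^sup>2) \<partial>M) \<le> ennreal (\<delta> * \<epsilon>\<^sup>2)"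
        unfolding S_def by (rule order_trans[OF YS[OF that] ennreal_leI[OF \<eta>(2)]])
    qed (use \<epsilon> \<open>0 < \<delta>\<close> in auto)
  qed
  have E2: "E2 t \<in> events" "prob (E2 t) \<le> \<delta>" if "t \<in> F" for t
  proof -
    have [measurable]: "quad_sum B \<rho> (d t) m \<in> borel_measurable M"
      by (rule random_variable_quad_sum[OF \<rho> order_refl])
    show "E2 t \<in> events" unfolding E2_def by measurable
    show "prob (E2 t) \<le> \<delta>"
      unfolding E2_def
      using prob_quad_sum_abs[OF \<rho> d_const[OF that] d_diag[OF that] d_energy[OF that] s(1) \<epsilon>(1)] s(2)
      by (rule order_trans)
  qed
  have E12: "E1 t \<union> E2 t \<in> events" "prob (E1 t \<union> E2 t) \<le> 2 * \<delta>" if "t \<in> F" for t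
    using E1[OF that] E2[OF that] measure_Un_le[of "E1 t" M "E2 t"] by auto
  have d_sum: "quad_sum B \<rho> (d t) m \<omega> = quad_sum B \<rho> f (r t) \<omega> - S t \<omega>" if "t \<in> F" for t \<omega>
  proof -
    have "quad_sum B \<rho> (restrict_kernel t f) m \<omega> = quad_sum B \<rho> f (r t) \<omega>"
      using quad_sum_restrict_kernel[OF \<rho>, of "r t" B f \<omega>] r that by simp
    moreover have "quad_sum B \<rho> (h t) m \<omega> = S t \<omega>"
      unfolding h_def S_def by (rule quad_sum_step_kernel[OF \<tau>[OF that] \<rho> sub[OF that]])
    ultimately show ?thesis unfolding d_def quad_sum_diff by simp
  qed
  \<comment> \<open>Outside \<open>E1 t\<close> and \<open>E2 t\<close>, passing from
    \<open>Y t\<close> to \<open>S t\<close> and from \<open>S t\<close> to the integral of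
    \<open>f\<close> up to \<open>t\<close> loses at most \<epsilon> each; hence the level x - 2 *
    \<epsilon> in \<open>E0\<close>.\<close>
  have incl: "{\<omega> \<in> space M. \<exists>t\<in>F. x < Y t \<omega>} \<subseteq> E0 \<union> (\<Union>t\<in>F. E1 t \<union> E2 t)"
  proof
    fix \<omega> assume "\<omega> \<in> {\<omega> \<in> space M. \<exists>t\<in>F. x < Y t \<omega>}"
    then obtain t where \<omega>: "\<omega> \<in> space M" and t: "t \<in> F" "x < Y t \<omega>" by blast
    have "\<omega> \<in> E0" if "\<not> \<epsilon> \<le> \<bar>Y t \<omega> - S t \<omega>\<bar>" "\<not> \<epsilon> < \<bar>quad_sum B \<rho> (d t) m \<omega>\<bar>"
    proof -
      have "x - 2 * \<epsilon> < quad_sum B \<rho> f (r t) \<omega>"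
        using that t(2) unfolding d_sum[OF t(1)] by linarith
      then show ?thesis using \<omega> r t(1) unfolding E0_def by blast
    qed
    then show "\<omega> \<in> E0 \<union> (\<Union>t\<in>F. E1 t \<union> E2 t)"
      using \<omega> t(1) unfolding E1_def E2_def by blast
  qed
  have UN: "(\<Union>t\<in>F. E1 t \<union> E2 t) \<in> events"
    using F(1) E12(1) by (intro sets.finite_UN) auto
  have "prob {\<omega> \<in> space M. \<exists>t\<in>F. x < Y t \<omega>} \<le> prob (E0 \<union> (\<Union>t\<in>F. E1 t \<union> E2 t))"
    by (rule finite_measure_mono[OF incl sets.Un[OF E0(1) UN]])
  also have "\<dots> \<le> prob E0 + prob (\<Union>t\<in>F. E1 t \<union> E2 t)"
    by (rule measure_Un_le[OF E0(1) UN])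
  also have "prob (\<Union>t\<in>F. E1 t \<union> E2 t) \<le> (\<Sum>t\<in>F. prob (E1 t \<union> E2 t))"
    using F(1) E12(1) by (intro measure_UNION_le) auto
  also have "\<dots> \<le> (\<Sum>t\<in>F. 2 * \<delta>)"
    by (intro sum_mono E12(2))
  finally show ?thesis using E0(2) by simp
qed

text \<open>For fixed \<epsilon> the error with \<delta> is removed first, \<open>F\<close> being
  finite; then \<epsilon> tends to 0 by continuity of the bound. The result no longer depends on the
  size of \<open>F\<close>.\<close>

lemma prob_finite_maximal:
  assumes g: "square_integrable_on_square T g"
    and Y: "\<And>t. t \<in> {0..T} \<Longrightarrow> is_double_wiener_ito_integral M T B
      (\<lambda>p. indicator ({0..t} \<times> {0..t}) p * g p) (Y t)"
    and F: "finite F" "F \<subseteq> {0..T}"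
    and \<sigma>: "L2_norm_square T g = \<sigma>" "0 < \<sigma>" and "0 < x"
  shows "prob {\<omega> \<in> space M. \<exists>t\<in>F. x < Y t \<omega>} \<le> 2 * exp (- tail_exponent x \<sigma>)"
proof (rule tendsto_lowerbound[OF tendsto_tail_bound[OF \<sigma>(2) \<open>0 < x\<close>]])
  have "\<forall>\<^sub>F \<epsilon> in at_right 0. \<epsilon> \<in> {0<..<x / 2}"
    using \<open>0 < x\<close> by (intro eventually_at_right_real) simp
  then show "\<forall>\<^sub>F \<epsilon> in at_right 0. prob {\<omega> \<in> space M. \<exists>t\<in>F. x < Y t \<omega>}
      \<le> 2 * exp (- tail_exponent (x - 2 * \<epsilon>) (\<sigma> + \<epsilon>))"
  proof eventually_elim
    fix \<epsilon> assume "\<epsilon> \<in> {0<..<x / 2}"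
    then have \<epsilon>: "0 < \<epsilon>" "2 * \<epsilon> < x" by auto
    show "prob {\<omega> \<in> space M. \<exists>t\<in>F. x < Y t \<omega>} \<le> 2 * exp (- tail_exponent (x - 2 * \<epsilon>) (\<sigma> + \<epsilon>))"
    proof (rule field_le_epsilon)
      fix e :: real assume "0 < e"
      \<comment> \<open>The summand 1 keeps the denominator positive when \<open>F\<close> is
        empty.\<close>
      define \<delta> where "\<delta> = e / (2 * (real (card F) + 1))"
      have "0 < \<delta>" using \<open>0 < e\<close> by (simp add: \<delta>_def)
      have "real (card F) * (2 * \<delta>) \<le> e"
        using \<open>0 < e\<close> by (simp add: \<delta>_def field_simps)
      then show "prob {\<omega> \<in> space M. \<exists>t\<in>F. x < Y t \<omega>}
          \<le> 2 * exp (- tail_exponent (x - 2 * \<epsilon>) (\<sigma> + \<epsilon>)) + e"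
        using prob_finite_maximal_approx[OF g Y F \<sigma> \<epsilon> \<open>0 < \<delta>\<close>] by linarith
    qed
  qed
qed simp

text \<open>The bound is uniform over finite sets of times, so it passes to a countable dense set by
  continuity from below, and to the whole interval by path continuity.\<close>

lemma prob_SUP_maximal:
  assumes g: "square_integrable_on_square T g"
    and Y: "is_double_wiener_ito_process M T B g Y"
    and \<sigma>: "L2_norm_square T g = \<sigma>" "0 < \<sigma>" and "0 < x"
  shows "prob {\<omega> \<in> space M. (SUP t\<in>{0..T}. Y t \<omega>) > x} \<le> 2 * exp (- tail_exponent x \<sigma>)"
proof -
  have Y_int: "is_double_wiener_ito_integral M T B (\<lambda>p. indicator ({0..t} \<times> {0..t}) p * g p) (Y t)"
    if "t \<in> {0..T}" for t
    using Y that by (simp add: is_double_wiener_ito_process_def)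
  have Y_meas: "Y t \<in> borel_measurable M" if "t \<in> {0..T}" for t
    using Y_int[OF that] by (simp add: is_double_wiener_ito_integral_def)
  obtain D where D: "countable D" "D \<subseteq> {0..T}" "{0..T} \<subseteq> closure D"
    using separable[of "{0..T}"] by blast
  have "D \<noteq> {}" using D(3) T_pos by auto
  define A where "A N = {\<omega> \<in> space M. \<exists>t\<in>from_nat_into D ` {..N}. x < Y t \<omega>}" for N :: nat
  have fin: "from_nat_into D ` {..N} \<subseteq> {0..T}" for N
    using from_nat_into[OF \<open>D \<noteq> {}\<close>] D(2) by blast
  have A_sets: "A N \<in> events" for N
  proof -
    have "Measurable.pred M (\<lambda>\<omega>. x < Y t \<omega>)" if "t \<in> from_nat_into D ` {..N}" for t
    proof -
      have [measurable]: "Y t \<in> borel_measurable M" using fin that by (intro Y_meas) blast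
      show ?thesis by measurable
    qed
    then have "Measurable.pred M (\<lambda>\<omega>. \<exists>t\<in>from_nat_into D ` {..N}. x < Y t \<omega>)"
      by (intro pred_intros_finite(4)) auto
    then show ?thesis unfolding A_def pred_def .
  qed
  have A_prob: "prob (A N) \<le> 2 * exp (- tail_exponent x \<sigma>)" for N
    unfolding A_def by (rule prob_finite_maximal[OF g Y_int _ fin \<sigma> \<open>0 < x\<close>]) simp_all
  have "(\<lambda>N. prob (A N)) \<longlonglongrightarrow> prob (\<Union>N. A N)"
  proof (rule finite_Lim_measure_incseq)
    show "range A \<subseteq> events" using A_sets by blast
    show "incseq A" by (rule incseq_SucI) (force simp: A_def)
  qed
  then have UN: "prob (\<Union>N. A N) \<le> 2 * exp (- tail_exponent x \<sigma>)"
    by (rule LIMSEQ_le_const2) (use A_prob in blast)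
  have "AE \<omega> in M. continuous_on {0..T} (\<lambda>t. Y t \<omega>)"
    using Y by (simp add: is_double_wiener_ito_process_def)
  then have "AE \<omega> in M. \<omega> \<in> {\<omega> \<in> space M. (SUP t\<in>{0..T}. Y t \<omega>) > x} \<longrightarrow> \<omega> \<in> (\<Union>N. A N)"
  proof eventually_elim
    fix \<omega> assume cont: "continuous_on {0..T} (\<lambda>t. Y t \<omega>)"
    show "\<omega> \<in> {\<omega> \<in> space M. (SUP t\<in>{0..T}. Y t \<omega>) > x} \<longrightarrow> \<omega> \<in> (\<Union>N. A N)"
    proof
      assume "\<omega> \<in> {\<omega> \<in> space M. (SUP t\<in>{0..T}. Y t \<omega>) > x}"
      then have \<omega>: "\<omega> \<in> space M" "x < (SUP t\<in>{0..T}. Y t \<omega>)" by auto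
      \<comment> \<open>If a continuous path stays at or below \<open>x\<close> on \<open>D\<close>,
        it does so on the closure of \<open>D\<close>, and the supremum cannot exceed
        \<open>x\<close>.\<close>
      have "\<exists>t\<in>D. x < Y t \<omega>"
      proof (rule ccontr)
        assume "\<not> (\<exists>t\<in>D. x < Y t \<omega>)"
        then have le: "\<And>t. t \<in> D \<Longrightarrow> Y t \<omega> \<le> x" by (simp add: not_less)
        have "closure D = {0..T}"
          using D(2,3) closure_minimal[OF D(2)] by (simp add: subset_antisym)
        then have "\<And>t. t \<in> {0..T} \<Longrightarrow> Y t \<omega> \<le> x"
          using continuous_le_on_closure[of D "\<lambda>t. Y t \<omega>" _ x] cont le by simp
        then have "(SUP t\<in>{0..T}. Y t \<omega>) \<le> x"
          using T_pos by (intro cSUP_least) auto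
        then show False using \<omega>(2) by simp
      qed
      then obtain t where t: "t \<in> D" "x < Y t \<omega>" by blast
      then have "t \<in> from_nat_into D ` {..to_nat_on D t}"
        using D(1) by (force simp: image_iff)
      then show "\<omega> \<in> (\<Union>N. A N)" using \<omega>(1) t(2) unfolding A_def by blast
    qed
  qed
  moreover have "(\<Union>N. A N) \<in> events" using A_sets by blast
  \<comment> \<open>Only the larger set has to be known to be an event, so no separate measurability
    argument for the supremum is made.\<close>
  ultimately have "prob {\<omega> \<in> space M. (SUP t\<in>{0..T}. Y t \<omega>) > x} \<le> prob (\<Union>N. A N)"
    by (rule finite_measure_mono_AE)
  with UN show ?thesis by linarith
qed

end

theorem proposition4p2:
  fixes M :: "'a measure" and T x :: real
    and B Y :: "real \<Rightarrow> 'a \<Rightarrow> real" and g :: "real \<times> real \<Rightarrow> real"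
  assumes "brownian_motion M T B"
    and "square_integrable_on_square T g"
    and "\<And>s \<theta>. s \<in> {0..T} \<Longrightarrow> \<theta> \<in> {0..T} \<Longrightarrow> g (s, \<theta>) = g (\<theta>, s)"
    and "is_double_wiener_ito_process M T B g Y"
    and "0 \<le> x"
  shows "measure M {\<omega> \<in> space M. (SUP t\<in>{0..T}. Y t \<omega>) > x} \<le>
    2 * exp (- (x\<^sup>2 / (L2_norm_square T g +
      sqrt ((L2_norm_square T g)\<^sup>2 + sqrt 8 * L2_norm_square T g * x))\<^sup>2))"
proof -
  interpret brownian_motion M T B by fact
  have "0 \<le> L2_norm_square T g" by (simp add: L2_norm_square_def)
  \<comment> \<open>If \<open>x\<close> is 0, or if the norm is 0 and the division by zero yields 0,
    the exponent is 0. The right-hand side is then 2 and the inequality is trivial.\<close>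
  then consider "L2_norm_square T g = 0 \<or> x = 0" | "0 < L2_norm_square T g" "0 < x"
    using \<open>0 \<le> x\<close> by linarith
  then show ?thesis
  proof cases
    case 1
    then have zero: "x\<^sup>2 / (L2_norm_square T g +
      sqrt ((L2_norm_square T g)\<^sup>2 + sqrt 8 * L2_norm_square T g * x))\<^sup>2 = 0"
      by auto
    show ?thesis unfolding zero by (intro order_trans[OF prob_le_1]) simp
  next
    case 2
    then show ?thesis
      using prob_SUP_maximal[OF assms(2,4) refl] by (simp only: tail_exponent_def)
  qed
qed

end
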